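(* Let $p$ be a prime, $r\ge1$, and let $n,k\ge 1$, $\delta\ge0$ be integers with $k\mid\delta$. Put $k_0=\lfloor k/r\rfloor$, $R=k-k_0r$, $\nu=\delta/k$, $\widetilde k=\lceil k/r\rceil$ and $\widetilde\delta=\widetilde k\nu$, and suppose $\widetilde k<n$. Let $\widetilde{\mathcal C}$ be an MDP convolutional code over the field $\mathbb Z_p$ of length $n$, dimension $\widetilde k$ and degree $\widetilde\delta$, and let $\widetilde G(D)=\sum_{0\le i\le\nu}\widetilde G_iD^i\in\mathbb Z_p^{\widetilde k\times n}[D]$ be a minimal basic encoder of $\widetilde{\mathcal C}$. If $r\nmid k$, write $$\widetilde G(D)=\begin{bmatrix}\widetilde{\mathcal G}_0(D)\\ \widetilde{\mathcal G}_{r-R}(D)\end{bmatrix}$$ where $\widetilde{\mathcal G}_0(D)$ has $k_0$ rows and $\widetilde{\mathcal G}_{r-R}(D)$ has one row; if $r\mid k$, put $\widetilde{\mathcal G}_0(D)=\widetilde G(D)$ and let $\widetilde{\mathcal G}_{r-R}(D)$ be empty. Regard the coefficients as elements of $\mathcal A_p=\{0,1,\dots,p-1\}\subset\mathbb Z_{p^r}$ and set $$G(D)=\begin{bmatrix}\widetilde{\mathcal G}_0(D)\\ p\,\widetilde{\mathcal G}_0(D)\\ \vdots\\ p^{r-1}\widetilde{\mathcal G}_0(D)\\ p^{r-R}\,\widetilde{\mathcal G}_{r-R}(D)\\ p^{r-R+1}\,\widetilde{\mathcal G}_{r-R}(D)\\ \vdots\\ p^{r-1}\,\widetilde{\mathcal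 G}_{r-R}(D)\end{bmatrix}\in\mathbb Z_{p^r}^{k\times n}[D].$$ Let $\mathcal C$ be the convolutional code over $\mathbb Z_{p^r}$ with $p$-encoder $G(D)$. Then $\mathcal C$ is an MDP $(n,k,\delta)$-convolutional code over $\mathbb Z_{p^r}$.
   Context: Codes over the field $\mathbb Z_p$: a convolutional code of length $n$ and dimension $\widetilde k$ is $\widetilde{\mathcal C}=\{u(D)\widetilde G(D):u(D)\in\mathbb Z_p^{\widetilde k}((D))\}$ with $\widetilde G(D)\in\mathbb Z_p^{\widetilde k\times n}[D]$ of rank $\widetilde k$. The encoder $\widetilde G(D)$ is minimal basic if it is left prime and the matrix $\widetilde G^{lc}$ of leading coefficient vectors of its rows has full row rank over $\mathbb Z_p$; the degree $\widetilde\delta$ of $\widetilde{\mathcal C}$ is the sum of the row degrees of a minimal basic encoder. With $\operatorname{wt}$ the Hamming weight (summed over all coefficients for series) and $v(D)|_{[0,j]}=\sum_{i=0}^jv_iD^i$, the $j$-th column distance is $\widetilde d^c_j=\min\{\operatorname{wt}(v(D)|_{[0,j]}):v(D)=u(D)\widetilde G(D),\ u(D)=\sum_{i\ge0}u_iD^i,\ u_0\ne0\}$. The code $\widetilde{\mathcal C}$ is MDP if $\widetilde d^c_j=(j+1)(n-\widetilde k)+1$ for all $j\le\widetilde L:=\lfloor\widetilde\delta/\widetilde k\rfloor+\lfloor\widetilde\delta/(n-\widetilde k)\rfloor$. Codes over $\mathbb Z_{p^r}$: $\mathcal A_p((D))$ and $\mathcal A_p[D]$ are the sets of Laurent series and polynomials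 with coefficients in $\mathcal A_p$. A $p$-linear combination of $v_1,\dots,v_k\in\mathbb Z_{p^r}^n[D]$ is $\sum_ja_jv_j$ with $a_j\in\mathcal A_p[D]$ (for vectors in $\mathbb Z_{p^r}^n$, $a_j\in\mathcal A_p$). $(v_1,\dots,v_k)$ is a $p$-generator sequence if $pv_i$ is a $p$-linear combination of $v_{i+1},\dots,v_k$ for $i<k$ and $pv_k=0$. Vectors are $p$-linearly independent if only the trivial $p$-linear combination of them is $0$. A $p$-basis is a $p$-linearly independent $p$-generator sequence; it is reduced if the leading coefficient vectors (coefficient vectors of the highest power of $D$) are $p$-linearly independent. A convolutional code of length $n$ over $\mathbb Z_{p^r}$ is a $\mathbb Z_{p^r}((D))$-submodule of $\mathbb Z_{p^r}^n((D))$ generated by the rows of a polynomial matrix. A $p$-encoder of $\mathcal C$ is a matrix $G(D)\in\mathbb Z_{p^r}^{k\times n}[D]$ whose rows form a $p$-basis and with $\mathcal C=\{u(D)G(D):u(D)\in\mathcal A_p^k((D))\}$; $k$ is the $p$-dimension of $\mathcal C$. A $p$-encoder is delay-free if for all $u(D)\in\mathcal A_p^k((D))$ and $N\in\mathbb Z$, $\operatorname{supp}(u(D)G(D))\subset[N,\infty)$ implies $\operatorname{supp}(u(D))\subset[N,\infty)$. It is noncatastrophic if $u(D)\in\mathcal A_p^k((D))$ and $u(D)G(D)\in\mathbb Z_{p^r}^n[D]$ imply $u(D)\in\mathcal A_p^k[D]$. A minimal $p$-encoder is a delay-free noncatastrophic $p$-encoder whose rows form a reduced $p$-basis; the $p$-degree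 is the sum of its row degrees. An $(n,k,\delta)$-convolutional code over $\mathbb Z_{p^r}$ is one of length $n$ admitting a noncatastrophic $p$-encoder (hence a minimal one), with $p$-dimension $k$ and $p$-degree $\delta$. The $j$-th column distance $d^c_j$ of $\mathcal C$ is $\min\{\operatorname{wt}(v(D)|_{[0,j]}):v(D)=u(D)G(D),\ u(D)=\sum_{i\ge0}u_iD^i\in\mathcal A_p^k((D)),\ u_0\neq0\}$ for any delay-free $p$-encoder $G(D)$ of $\mathcal C$ (independent of the choice). An $(n,k,\delta)$-convolutional code over $\mathbb Z_{p^r}$ is Maximum Distance Profile (MDP) if $d^c_j=B(j)$ for all $j\le L$, where $$B(j)=\Bigl(n-\Bigl\lceil\tfrac kr\Bigr\rceil\Bigr)(j+1)+1,\qquad L=\max\{j:B(j)\le SB\},$$ $$SB=n\Bigl(\Bigl\lfloor\tfrac\delta k\Bigr\rfloor+1\Bigr)-\Bigl\lceil\tfrac kr\Bigl(\Bigl\lfloor\tfrac\delta k\Bigr\rfloor+1\Bigr)-\tfrac\delta r\Bigr\rceil+1 .$$ *)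

theory Defs
  imports
    "Jordan_Normal_Form.DL_Rank"
    "Berlekamp_Zassenhaus.Finite_Field"
    "HOL-Computational_Algebra.Formal_Laurent_Series"
    "HOL-Computational_Algebra.Polynomial_FPS"
    "HOL-Computational_Algebra.Polynomial_Factorial"
begin

section \<open>Polynomial matrices and encoding\<close>

definition poly_fls :: "'a::zero poly \<Rightarrow> 'a fls" where
  "poly_fls f = fps_to_fls (fps_of_poly f)"

text \<open>Codewords are row vectors \<open>u(D) G(D)\<close>. The matrix library only multiplies by column
  vectors, so this is written as \<open>G(D)\<^sup>T u(D)\<close>.\<close>

definition encode :: "'a::comm_ring_1 poly mat \<Rightarrow> 'a fls vec \<Rightarrow> 'a fls vec" where
  "encode G u = transpose_mat (map_mat poly_fls G) *\<^sub>v u"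

definition laurent_vecs :: "'a::zero set \<Rightarrow> nat \<Rightarrow> 'a fls vec set" where
  "laurent_vecs A k = {u \<in> carrier_vec k. \<forall>i<k. \<forall>m. fls_nth (u $ i) m \<in> A}"

definition supported_from :: "int \<Rightarrow> 'a::zero fls vec \<Rightarrow> bool" where
  "supported_from N v \<longleftrightarrow> (\<forall>i<dim_vec v. \<forall>m<N. fls_nth (v $ i) m = 0)"

definition polynomial_vec :: "'a::zero fls vec \<Rightarrow> bool" where
  "polynomial_vec v \<longleftrightarrow> (\<forall>i<dim_vec v. v $ i \<in> range poly_fls)"

definition row_degree :: "'a::zero poly mat \<Rightarrow> nat \<Rightarrow> nat" where
  "row_degree G i = Max ((\<lambda>l. degree (G $$ (i, l))) ` {..<dim_col G})"

definition leading_mat :: "'a::zero poly mat \<Rightarrow> 'a mat" where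
  "leading_mat G =
     mat (dim_row G) (dim_col G) (\<lambda>(i, l). poly.coeff (G $$ (i, l)) (row_degree G i))"

definition truncated_weight :: "nat \<Rightarrow> 'a::zero fls vec \<Rightarrow> nat" where
  "truncated_weight j v =
     card {(i, m). i < dim_vec v \<and> m \<in> {0..int j} \<and> fls_nth (v $ i) m \<noteq> 0}"

text \<open>The set \<open>A\<close> is the alphabet of the input coefficients: all of \<open>\<int>\<^sub>p\<close> for codes over the
  field, \<open>{0, \<dots>, p - 1}\<close> for codes over \<open>\<int>\<close> modulo \<open>p ^ r\<close>.\<close>

definition column_distance :: "'a::comm_ring_1 set \<Rightarrow> 'a poly mat \<Rightarrow> nat \<Rightarrow> nat" where
  "column_distance A G j =
     Min {truncated_weight j (encode G u) | u.
       u \<in> laurent_vecs A (dim_row G) \<and> supported_from 0 u \<and>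
       (\<exists>i<dim_row G. fls_nth (u $ i) 0 \<noteq> 0)}"


section \<open>Convolutional codes over a field\<close>

text \<open>The rank of a polynomial matrix is taken over the field of rational functions.\<close>

definition field_encoder ::
    "nat \<Rightarrow> nat \<Rightarrow> 'f::field poly mat \<Rightarrow> 'f fls vec set \<Rightarrow> bool" where
  "field_encoder n k G C \<longleftrightarrow>
     G \<in> carrier_mat k n \<and> vec_space.rank k (map_mat to_fract G) = k \<and>
     C = encode G ` carrier_vec k"

definition left_prime :: "'f::field poly mat \<Rightarrow> bool" where
  "left_prime G \<longleftrightarrow>
     (\<forall>M G'. M \<in> carrier_mat (dim_row G) (dim_row G) \<longrightarrow>
        G' \<in> carrier_mat (dim_row G) (dim_col G) \<longrightarrow> G = M * G' \<longrightarrow> invertible_mat M)"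

definition minimal_basic_encoder ::
    "nat \<Rightarrow> nat \<Rightarrow> 'f::field poly mat \<Rightarrow> 'f fls vec set \<Rightarrow> bool" where
  "minimal_basic_encoder n k G C \<longleftrightarrow>
     field_encoder n k G C \<and> left_prime G \<and> vec_space.rank k (leading_mat G) = k"

text \<open>The row degree sum and the column distances are the same for all minimal basic encoders
  of \<open>C\<close>, so the choice of \<open>G\<close> is immaterial.\<close>

definition field_mdp_code ::
    "nat \<Rightarrow> nat \<Rightarrow> nat \<Rightarrow> 'f::field fls vec set \<Rightarrow> bool" where
  "field_mdp_code n k \<delta> C \<longleftrightarrow>
     (\<exists>G. minimal_basic_encoder n k G C \<and> (\<Sum>i<k. row_degree G i) = \<delta> \<and>
        (\<forall>j \<le> \<delta> div k + \<delta> div (n - k).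
           column_distance UNIV G j = (j + 1) * (n - k) + 1))"


section \<open>Convolutional codes over the integers modulo a prime power\<close>

definition digits :: "nat \<Rightarrow> 'a::semiring_1 set" where
  "digits p = of_nat ` {0..<p}"

definition digit_polys :: "nat \<Rightarrow> 'a::semiring_1 poly set" where
  "digit_polys p = {f. \<forall>i. poly.coeff f i \<in> digits p}"

definition comb_rows :: "'c::semiring_1 mat \<Rightarrow> nat set \<Rightarrow> (nat \<Rightarrow> 'c) \<Rightarrow> 'c vec" where
  "comb_rows M J a = vec (dim_col M) (\<lambda>l. \<Sum>j\<in>J. a j * M $$ (j, l))"

text \<open>The next two notions are used with \<open>S\<close> the digit polynomials for matrices over the
  polynomial ring, and with \<open>S\<close> the digits for constant matrices. In \<open>p_generator_seq\<close> the
  condition on the last row says that \<open>p\<close> annihilates it, as the sum is then empty.\<close>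

definition p_generator_seq :: "nat \<Rightarrow> 'c::semiring_1 set \<Rightarrow> 'c mat \<Rightarrow> bool" where
  "p_generator_seq p S M \<longleftrightarrow>
     (\<forall>i<dim_row M. \<exists>a. (\<forall>j. a j \<in> S) \<and>
        of_nat p \<cdot>\<^sub>v row M i = comb_rows M {i<..<dim_row M} a)"

definition p_lin_indep :: "'c::semiring_1 set \<Rightarrow> 'c mat \<Rightarrow> bool" where
  "p_lin_indep S M \<longleftrightarrow>
     (\<forall>a. (\<forall>j<dim_row M. a j \<in> S) \<longrightarrow>
        comb_rows M {..<dim_row M} a = 0\<^sub>v (dim_col M) \<longrightarrow> (\<forall>j<dim_row M. a j = 0))"

definition p_basis :: "nat \<Rightarrow> 'a::comm_ring_1 poly mat \<Rightarrow> bool" where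
  "p_basis p G \<longleftrightarrow> p_generator_seq p (digit_polys p) G \<and> p_lin_indep (digit_polys p) G"

definition reduced_p_basis :: "nat \<Rightarrow> 'a::comm_ring_1 poly mat \<Rightarrow> bool" where
  "reduced_p_basis p G \<longleftrightarrow> p_basis p G \<and> p_lin_indep (digits p) (leading_mat G)"

definition ring_conv_code :: "nat \<Rightarrow> 'a::comm_ring_1 fls vec set \<Rightarrow> bool" where
  "ring_conv_code n C \<longleftrightarrow> (\<exists>m. \<exists>G\<in>carrier_mat m n. C = encode G ` carrier_vec m)"

definition p_encoder ::
    "nat \<Rightarrow> nat \<Rightarrow> nat \<Rightarrow> 'a::comm_ring_1 poly mat \<Rightarrow> 'a fls vec set \<Rightarrow> bool" where
  "p_encoder p n k G C \<longleftrightarrow>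
     G \<in> carrier_mat k n \<and> p_basis p G \<and> C = encode G ` laurent_vecs (digits p) k"

definition delay_free :: "nat \<Rightarrow> 'a::comm_ring_1 poly mat \<Rightarrow> bool" where
  "delay_free p G \<longleftrightarrow>
     (\<forall>u\<in>laurent_vecs (digits p) (dim_row G). \<forall>N.
        supported_from N (encode G u) \<longrightarrow> supported_from N u)"

definition noncatastrophic :: "nat \<Rightarrow> 'a::comm_ring_1 poly mat \<Rightarrow> bool" where
  "noncatastrophic p G \<longleftrightarrow>
     (\<forall>u\<in>laurent_vecs (digits p) (dim_row G).
        polynomial_vec (encode G u) \<longrightarrow> polynomial_vec u)"

definition minimal_p_encoder ::
    "nat \<Rightarrow> nat \<Rightarrow> nat \<Rightarrow> 'a::comm_ring_1 poly mat \<Rightarrow> 'a fls vec set \<Rightarrow> bool" where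
  "minimal_p_encoder p n k G C \<longleftrightarrow>
     p_encoder p n k G C \<and> delay_free p G \<and> noncatastrophic p G \<and> reduced_p_basis p G"

text \<open>A code with a noncatastrophic \<open>p\<close>-encoder has a minimal one, and the \<open>p\<close>-degree is read
  off from the latter.\<close>

definition nkd_code ::
    "nat \<Rightarrow> nat \<Rightarrow> nat \<Rightarrow> nat \<Rightarrow> 'a::comm_ring_1 fls vec set \<Rightarrow> bool" where
  "nkd_code p n k \<delta> C \<longleftrightarrow>
     ring_conv_code n C \<and>
     (\<exists>G. minimal_p_encoder p n k G C \<and> (\<Sum>i<k. row_degree G i) = \<delta>)"

definition mdp_B :: "nat \<Rightarrow> nat \<Rightarrow> nat \<Rightarrow> nat \<Rightarrow> int" where
  "mdp_B r n k j = (int n - \<lceil>real k / real r\<rceil>) * (int j + 1) + 1"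

definition mdp_SB :: "nat \<Rightarrow> nat \<Rightarrow> nat \<Rightarrow> nat \<Rightarrow> int" where
  "mdp_SB r n k \<delta> =
     int n * (\<lfloor>real \<delta> / real k\<rfloor> + 1)
     - \<lceil>real k / real r * (of_int \<lfloor>real \<delta> / real k\<rfloor> + 1) - real \<delta> / real r\<rceil> + 1"

definition mdp_L :: "nat \<Rightarrow> nat \<Rightarrow> nat \<Rightarrow> nat \<Rightarrow> nat" where
  "mdp_L r n k \<delta> = Max {j. mdp_B r n k j \<le> mdp_SB r n k \<delta>}"

definition ring_mdp_code ::
    "nat \<Rightarrow> nat \<Rightarrow> nat \<Rightarrow> nat \<Rightarrow> nat \<Rightarrow> 'a::comm_ring_1 fls vec set \<Rightarrow> bool" where
  "ring_mdp_code p r n k \<delta> C \<longleftrightarrow>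
     nkd_code p n k \<delta> C \<and>
     (\<forall>G. p_encoder p n (dim_row G) G C \<and> delay_free p G \<longrightarrow>
        (\<forall>j \<le> mdp_L r n k \<delta>. int (column_distance (digits p) G j) = mdp_B r n k j))"


section \<open>The construction\<close>

text \<open>Coefficients of \<open>\<int>\<^sub>p\<close> are moved to \<open>\<int>\<close> modulo \<open>p ^ r\<close> via their representatives in
  \<open>{0, \<dots>, p - 1}\<close>; this map is not a ring homomorphism for \<open>r > 1\<close>.\<close>

definition lift_mat :: "'b::nontriv mod_ring poly mat \<Rightarrow> 'a::nontriv mod_ring poly mat" where
  "lift_mat = map_mat (map_poly (\<lambda>x. of_int (to_int_mod_ring x)))"

text \<open>Row \<open>i\<close> of the block matrix with \<open>k\<^sub>0 = k div r\<close> and \<open>R = k - k\<^sub>0 r\<close>: the first \<open>k\<^sub>0 r\<close> rows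
  are \<open>r\<close> blocks of \<open>k\<^sub>0\<close> rows each, with powers \<open>p ^ 0, \<dots>, p ^ (r - 1)\<close>; the remaining \<open>R\<close> rows
  are multiples of the last row (of index \<open>k\<^sub>0\<close>) of the field encoder by
  \<open>p ^ (r - R), \<dots>, p ^ (r - 1)\<close>.\<close>

definition block_encoder ::
    "nat \<Rightarrow> nat \<Rightarrow> nat \<Rightarrow> nat \<Rightarrow> 'b::nontriv mod_ring poly mat \<Rightarrow> 'a::nontriv mod_ring poly mat"
  where
  "block_encoder p r n k Gt =
     (let k0 = k div r; R = k - k0 * r in
      mat k n (\<lambda>(i, l).
        if i < k0 * r
        then of_nat p ^ (i div k0) * lift_mat Gt $$ (i mod k0, l)
        else of_nat p ^ (r - R + (i - k0 * r)) * lift_mat Gt $$ (k0, l)))"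

end

theory Submission
  imports Defs
begin

text \<open>
  Row \<open>i\<close> of the block encoder is \<open>p ^ e\<close> times the lift of row \<open>b\<close> of the field encoder, for a
  pair \<open>(b, e)\<close> that determines \<open>i\<close>. Sorting the digits of an input by the exponent \<open>e\<close> gives
  \<open>r\<close> layers, each of which is an input \<open>u\<^sub>e\<close> of the field encoder, and the codeword is the sum of
  \<open>p ^ e\<close> times the lifted layers. The map from \<open>\<int>\<^sub>p\<close> to digits is not additive for \<open>r > 1\<close>, but
  \<open>p ^ (r - 1)\<close> times it is an injective additive map onto the socle \<open>p ^ (r - 1) \<int>\<close> modulo
  \<open>p ^ r\<close>, and it is compatible with products. So multiplying a codeword by \<open>p ^ (r - 1 - e)\<close>
  removes the layers above \<open>e\<close> and turns layer \<open>e\<close> into a copy of the field codeword with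
  input \<open>u\<^sub>e\<close>; what remains comes from the layers below \<open>e\<close> (lemma \<open>peel_layers\<close>). Everything is an
  induction on \<open>e\<close> along this identity.

  Minimality. Being delay-free and being noncatastrophic both say that if the word has its support
  in a certain class of sets of times, then so has the input. Such statements pass from the
  field encoder to the block encoder (\<open>reflects_support\<close>). Over the field both follow from left
  primeness: a polynomial \<open>d\<close> that divides \<open>w G\<close> divides \<open>w\<close> (\<open>left_prime_imp_dvd_coeffs\<close>). With
  \<open>d = D\<close> this makes \<open>G(0)\<close> injective, hence \<open>G\<close> delay-free; with \<open>d\<close> the denominator of a
  rational right inverse of \<open>G\<close>, it makes every input with a polynomial word polynomial. A delay-free
  encoder has \<open>p\<close>-linearly independent rows, and the leading coefficient matrix of the block encoder
  is again a block encoder, built from constants, so the basis is reduced.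

  Row degrees. The field encoder has row degrees at most \<open>\<nu>\<close>. A shorter row would be a codeword
  of weight at most \<open>n \<nu>\<close>, too small for the column distance at \<open>\<nu> + kt \<nu> div (n - kt)\<close>.
  This index is also the largest \<open>j\<close> with \<open>B(j) \<le> SB\<close>, so the field code supplies exactly the
  column distances needed.

  Column distances. They depend on the code only, because under a delay-free encoder a word starts at
  time 0 exactly if its input does. The socle copy of a field codeword of least weight gives one
  inequality. For the other, a layer may start later than the input and then is bounded only on the
  window in which it lives. Suppose the bound fails and take the first \<open>j\<close> where it does. As it holds
  before \<open>j\<close>, the word has weight at most \<open>(j - t + 1)(n - kt)\<close> on each window \<open>[t, j]\<close>, less
  than any field codeword that starts at \<open>t\<close>. So by induction on \<open>e\<close> no layer can start at or before
  \<open>j\<close>, although the input starts at 0 (\<open>truncated_weight_ge\<close>).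
\<close>

text \<open>The dollar sign below always selects an entry of a vector, never a coefficient of a power
  series.\<close>

no_notation fps_nth (infixl "$" 75)

section \<open>Codewords as sums of Laurent series\<close>

lemma fls_nth_poly_fls: "fls_nth (poly_fls f) m = (if m < 0 then 0 else poly.coeff f (nat m))"
  by (simp add: poly_fls_def)

lemma poly_fls_0 [simp]: "poly_fls 0 = 0"
  and poly_fls_add: "poly_fls (f + g) = poly_fls f + poly_fls g"
  by (simp_all add: poly_fls_def fps_of_poly_add)

lemma poly_fls_mult: "poly_fls (f * g) = poly_fls f * poly_fls (g :: 'a::comm_ring_1 poly)"
  by (simp add: poly_fls_def fps_of_poly_mult fls_times_fps_to_fls)

lemma poly_fls_pCons: "poly_fls (pCons a f) = fls_const a + fls_X * poly_fls (f :: 'a::comm_ring_1 poly)"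
  by (intro fls_eqI) (auto simp: fls_nth_poly_fls fls_X_times_conv_shift coeff_pCons nat_diff_distrib split: nat.splits)

lemma fls_nth_X_mult: "fls_nth (fls_X * x) m = fls_nth x (m - 1)" for x :: "'a::comm_ring_1 fls"
  by (simp add: fls_X_times_conv_shift)

lemma poly_fls_inject: "poly_fls f = poly_fls g \<longleftrightarrow> f = g"
  by (simp add: poly_fls_def fps_of_poly_eq_iff)

lemma poly_fls_sum: "poly_fls (\<Sum>i\<in>A. f i) = (\<Sum>i\<in>A. poly_fls (f i))"
  by (induction A rule: infinite_finite_induct) (simp_all add: poly_fls_add)

text \<open>The summation range may exceed the degree, so that products with different factors can be compared
  term by term.\<close>

lemma fls_nth_poly_fls_mult:
  fixes x :: "'a::comm_ring_1 fls"
  assumes "degree f \<le> N"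
  shows "fls_nth (poly_fls f * x) m = (\<Sum>t\<le>N. poly.coeff f t * fls_nth x (m - int t))"
  using assms
proof (induction f arbitrary: m N)
  case 0
  then show ?case by simp
next
  case (pCons a f)
  show ?case
  proof (cases N)
    case 0
    then show ?thesis using pCons by (simp add: poly_fls_pCons fls_mult_const_nth(1) split: if_splits)
  next
    case (Suc N')
    have "degree f \<le> N'" using pCons.prems Suc by (cases "f = 0") auto
    then show ?thesis
      unfolding Suc sum.atMost_Suc_shift
      by (simp add: poly_fls_pCons distrib_right mult.assoc fls_mult_const_nth(1) fls_nth_X_mult
          pCons.IH diff_diff_eq)
  qed
qed

lemma dim_vec_encode [simp]: "dim_vec (encode G u) = dim_col G"
  by (simp add: encode_def mult_mat_vec_def)

lemma encode_index:
  assumes "u \<in> carrier_vec (dim_row G)" "l < dim_col G"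
  shows "encode G u $ l = (\<Sum>i<dim_row G. poly_fls (G $$ (i, l)) * u $ i)"
  using assms by (simp add: encode_def scalar_prod_def atLeast0LessThan)


section \<open>Column distances and delay\<close>

lemma supported_from_encode:
  assumes "u \<in> carrier_vec (dim_row G)" "supported_from N u"
  shows "supported_from N (encode G u)"
proof -
  have "fls_nth (poly_fls (G $$ (i, l)) * u $ i) m = 0" if "m < N" "i < dim_row G" for i l m
    using assms that by (auto simp: fls_nth_poly_fls_mult[OF order.refl] supported_from_def)
  then show ?thesis
    using assms(1) by (simp add: supported_from_def[of _ "encode G u"] encode_index fls_nth_sum)
qed

text \<open>The condition on inputs in the definition of the column distance. It makes sense for words as well,
  and a delay-free encoder does not change it.\<close>

definition starts_at_zero :: "'a::zero fls vec \<Rightarrow> bool" where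
  "starts_at_zero v \<longleftrightarrow> supported_from 0 v \<and> (\<exists>i<dim_vec v. fls_nth (v $ i) 0 \<noteq> 0)"

lemma starts_at_zero_iff: "starts_at_zero v \<longleftrightarrow> supported_from 0 v \<and> \<not> supported_from 1 v"
proof -
  have "m < 0 \<or> m = 0" if "m < 1" for m :: int using that by linarith
  then show ?thesis by (fastforce simp: starts_at_zero_def supported_from_def)
qed

text \<open>Delay-freeness for an arbitrary input alphabet, so that field encoders and \<open>p\<close>-encoders share
  the treatment of column distances.\<close>

definition reflects_delay :: "'a::comm_ring_1 set \<Rightarrow> 'a poly mat \<Rightarrow> bool" where
  "reflects_delay A G \<longleftrightarrow> (\<forall>u\<in>laurent_vecs A (dim_row G). \<forall>N.
     supported_from N (encode G u) \<longrightarrow> supported_from N u)"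

lemma delay_free_iff: "delay_free p G \<longleftrightarrow> reflects_delay (digits p) G"
  by (simp add: delay_free_def reflects_delay_def)

lemma starts_at_zero_encode_iff:
  assumes "reflects_delay A G" and u: "u \<in> laurent_vecs A (dim_row G)"
  shows "starts_at_zero (encode G u) \<longleftrightarrow> starts_at_zero u"
proof -
  have "u \<in> carrier_vec (dim_row G)" using u by (simp add: laurent_vecs_def)
  then have "supported_from N u \<longleftrightarrow> supported_from N (encode G u)" for N
    using assms supported_from_encode unfolding reflects_delay_def by blast
  then show ?thesis by (simp add: starts_at_zero_iff)
qed

text \<open>A delay-free encoder maps the inputs that start at time 0 to the words that start at time 0, so the
  encoder enters only through the set of words.\<close>

lemma column_distance_altdef:
  assumes "reflects_delay A G"
  shows "column_distance A G j =
    Min (truncated_weight j ` {v \<in> encode G ` laurent_vecs A (dim_row G). starts_at_zero v})"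
proof -
  have "{truncated_weight j (encode G u) | u. u \<in> laurent_vecs A (dim_row G) \<and>
          supported_from 0 u \<and> (\<exists>i<dim_row G. fls_nth (u $ i) 0 \<noteq> 0)} =
      {truncated_weight j (encode G u) | u. u \<in> laurent_vecs A (dim_row G) \<and> starts_at_zero u}"
    by (rule arg_cong[where f = Collect]) (fastforce simp: starts_at_zero_def laurent_vecs_def)
  also have "\<dots> =
      {truncated_weight j (encode G u) | u. u \<in> laurent_vecs A (dim_row G) \<and> starts_at_zero (encode G u)}"
    using starts_at_zero_encode_iff[OF assms] by blast
  also have "\<dots> = truncated_weight j ` {v \<in> encode G ` laurent_vecs A (dim_row G). starts_at_zero v}"
    by blast
  finally show ?thesis by (simp add: column_distance_def)
qed

lemma truncated_weight_le: "truncated_weight j v \<le> dim_vec v * Suc j"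
proof -
  have "truncated_weight j v \<le> card ({..<dim_vec v} \<times> {0..int j})"
    unfolding truncated_weight_def by (intro card_mono) auto
  then show ?thesis by (simp add: nat_add_distrib)
qed

lemma finite_truncated_weights:
  "finite (truncated_weight j ` {v \<in> encode G ` U. starts_at_zero v})"
  by (rule finite_subset[of _ "{..dim_col G * Suc j}"])
     (use truncated_weight_le[of j "encode G _"] in auto)

lemma column_distance_le:
  assumes "reflects_delay A G" "u \<in> laurent_vecs A (dim_row G)" "starts_at_zero u"
  shows "column_distance A G j \<le> truncated_weight j (encode G u)"
  unfolding column_distance_altdef[OF assms(1)]
  using assms by (intro Min_le finite_truncated_weights imageI) (simp add: starts_at_zero_encode_iff)

lemma column_distance_attained:
  assumes "reflects_delay A G" "\<exists>u \<in> laurent_vecs A (dim_row G). starts_at_zero u"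
  shows "\<exists>u \<in> laurent_vecs A (dim_row G). starts_at_zero u \<and>
    truncated_weight j (encode G u) = column_distance A G j"
proof -
  have "column_distance A G j \<in> truncated_weight j ` {v \<in> encode G ` laurent_vecs A (dim_row G). starts_at_zero v}"
    unfolding column_distance_altdef[OF assms(1)]
    using assms by (intro Min_in finite_truncated_weights) (auto simp: starts_at_zero_encode_iff)
  then show ?thesis using starts_at_zero_encode_iff[OF assms(1)] by auto
qed

text \<open>A row is itself the word of a unit vector, and its weight is at most \<open>n\<close> times its number of
  coefficients. At the index chosen here the column distance exceeds \<open>n \<nu>\<close>.\<close>

lemma row_degree_ge_if_column_distance:
  fixes G :: "'f::field poly mat"
  assumes G: "G \<in> carrier_mat k n" and delay: "reflects_delay UNIV G" and i: "i < k" and "k < n"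
    and dist: "column_distance UNIV G (\<nu> + k * \<nu> div (n - k)) =
      (\<nu> + k * \<nu> div (n - k) + 1) * (n - k) + 1"
  shows "\<nu> \<le> row_degree G i"
proof (rule ccontr)
  assume short: "\<not> \<nu> \<le> row_degree G i"
  let ?x = "vec k (\<lambda>j. if j = i then 1 else 0 :: 'f fls)" and ?j = "\<nu> + k * \<nu> div (n - k)"
  have "starts_at_zero ?x"
    using i by (auto simp: starts_at_zero_def supported_from_def)
  moreover have "?x \<in> laurent_vecs UNIV (dim_row G)" using G by (simp add: laurent_vecs_def)
  ultimately have "column_distance UNIV G ?j \<le> truncated_weight ?j (encode G ?x)"
    using column_distance_le[OF delay] by blast
  also have "\<dots> \<le> card ({..<n} \<times> {0..int (row_degree G i)})"
    unfolding truncated_weight_def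
  proof (intro card_mono subsetI)
    fix z assume "z \<in> {(l, m). l < dim_vec (encode G ?x) \<and> m \<in> {0..int ?j} \<and>
        fls_nth (encode G ?x $ l) m \<noteq> 0}"
    then obtain l m where z: "z = (l, m)" "l < n" "0 \<le> m" "fls_nth (encode G ?x $ l) m \<noteq> 0"
      using G by auto
    have "encode G ?x $ l = (\<Sum>j<k. if j = i then poly_fls (G $$ (i, l)) else 0)"
      using G z(2) by (simp add: encode_index if_distrib[of "\<lambda>x. _ * x"] cong: if_cong)
    then have "poly.coeff (G $$ (i, l)) (nat m) \<noteq> 0"
      using i z(3,4) by (simp add: fls_nth_poly_fls)
    then have "nat m \<le> degree (G $$ (i, l))" by (rule le_degree)
    also have "\<dots> \<le> row_degree G i"
      unfolding row_degree_def using G z(2) by (intro Max_ge) auto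
    finally show "z \<in> {..<n} \<times> {0..int (row_degree G i)}" using z by auto
  qed auto
  also have "\<dots> = n * Suc (row_degree G i)" by (simp add: nat_add_distrib)
  also have "\<dots> \<le> n * \<nu>" using short by (intro mult_le_mono2) simp
  also have "\<dots> = \<nu> * (n - k) + k * \<nu>" using \<open>k < n\<close> by (simp add: algebra_simps)
  also have "k * \<nu> \<le> (k * \<nu> div (n - k) + 1) * (n - k)"
  proof -
    have "k * \<nu> mod (n - k) < n - k" using \<open>k < n\<close> by simp
    moreover have "(k * \<nu> div (n - k) + 1) * (n - k) = k * \<nu> div (n - k) * (n - k) + (n - k)"
      by (simp only: add_mult_distrib mult_1)
    ultimately show ?thesis using div_mult_mod_eq[of "k * \<nu>" "n - k"] by linarith
  qed
  finally show False unfolding dist by (simp add: algebra_simps)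
qed


section \<open>Minimal basic encoders over a field\<close>

text \<open>The columns span the whole space, so each unit vector is a combination of columns; the
  coefficients form the right inverse.\<close>

lemma full_rank_imp_right_inverse:
  fixes A :: "'a::field mat"
  assumes A: "A \<in> carrier_mat k n" and rank: "vec_space.rank k A = k"
  shows "\<exists>H \<in> carrier_mat n k. A * H = 1\<^sub>m k"
proof -
  interpret V: vec_space "TYPE('a)" k .
  have cols: "set (cols A) \<subseteq> carrier_vec k" using A cols_dim by blast
  have "V.lin_indpt {}" using V.lindep_span[of "{}"] by (auto simp: V.lin_dep_def)
  then obtain S where S: "maximal S (\<lambda>T. T \<subseteq> set (cols A) \<and> V.lin_indpt T)"
    using maximal_exists_superset[of "set (cols A)" "\<lambda>T. T \<subseteq> set (cols A) \<and> V.lin_indpt T" "{}"]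
    by auto
  then have S': "S \<subseteq> set (cols A)" "V.lin_indpt S" by (auto simp: maximal_def)
  have "card S = k" using V.rank_card_indpt[OF A S] rank by simp
  then have "V.basis S"
    using V.dim_li_is_basis[OF V.fin_dim, of S] S' cols finite_subset[OF S'(1)] by (auto simp: V.dim_is_n)
  then have "V.span S = carrier_vec k" by (simp add: V.basis_def)
  then have "carrier_vec k \<subseteq> V.col_space A"
    unfolding V.col_space_def using V.span_is_monotone[OF S'(1)] by simp
  then have "unit_vec k j \<in> V.col_space A" for j
    by (meson subsetD unit_vec_carrier)
  then have "\<exists>x\<in>carrier_vec n. A *\<^sub>v x = unit_vec k j" for j
    using A unfolding V.col_space_eq[OF A] by simp
  then obtain x where x: "x j \<in> carrier_vec n" "A *\<^sub>v x j = unit_vec k j" if "j < k" for j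
    by metis
  have "A * mat_of_cols n (map x [0..<k]) = 1\<^sub>m k"
  proof (rule eq_matI)
    fix i j assume "i < dim_row (1\<^sub>m k :: 'a mat)" "j < dim_col (1\<^sub>m k :: 'a mat)"
    then have ij: "i < k" "j < k" by auto
    have "(A * mat_of_cols n (map x [0..<k])) $$ (i, j) = (A *\<^sub>v x j) $ i"
      using A ij x(1) by simp
    then show "(A * mat_of_cols n (map x [0..<k])) $$ (i, j) = 1\<^sub>m k $$ (i, j)"
      using ij x(2) by (simp add: unit_vec_def)
  qed (use A in auto)
  then show ?thesis by (intro bexI[of _ "mat_of_cols n (map x [0..<k])"]) auto
qed

lemma finite_common_denominator:
  fixes S :: "'a::idom fract set"
  assumes "finite S"
  shows "\<exists>d. d \<noteq> 0 \<and> (\<forall>x\<in>S. \<exists>a. to_fract d * x = to_fract a)"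
  using assms
proof (induction S rule: finite_induct)
  case empty
  show ?case by (intro exI[of _ 1]) auto
next
  case (insert x S)
  then obtain d where d: "d \<noteq> 0" "\<And>y. y \<in> S \<Longrightarrow> \<exists>a. to_fract d * y = to_fract a" by blast
  obtain a b where x: "x = to_fract a / to_fract b" "b \<noteq> 0"
    by (cases x) (auto simp: Fract_conv_to_fract)
  have "to_fract (d * b) * x = to_fract (d * a)" using x by simp
  then have "\<exists>c. to_fract (d * b) * x = to_fract c" by blast
  moreover have "\<exists>c. to_fract (d * b) * y = to_fract c" if y: "y \<in> S" for y
  proof -
    obtain c where "to_fract d * y = to_fract c" using d(2)[OF y] by blast
    then have "to_fract (d * b) * y = to_fract (c * b)" by (simp add: ac_simps)
    then show ?thesis by blast
  qed
  moreover have "d * b \<noteq> 0" using d(1) x(2) by simp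
  ultimately show ?case by blast
qed

text \<open>Clearing denominators in a right inverse over the field of rational functions.\<close>

lemma full_rank_imp_pseudo_right_inverse:
  fixes G :: "'f::field poly mat"
  assumes G: "G \<in> carrier_mat k n" and rank: "vec_space.rank k (map_mat to_fract G) = k"
  obtains d K where "d \<noteq> 0"
    and "\<And>i j. i < k \<Longrightarrow> j < k \<Longrightarrow> (\<Sum>l<n. G $$ (i, l) * K l j) = (if i = j then d else 0)"
proof -
  obtain H where H: "H \<in> carrier_mat n k" "map_mat to_fract G * H = 1\<^sub>m k"
    using full_rank_imp_right_inverse[OF _ rank, of n] G by auto
  obtain d where d: "d \<noteq> 0"
    "\<And>x. x \<in> (\<lambda>(l, j). H $$ (l, j)) ` ({..<n} \<times> {..<k}) \<Longrightarrow> \<exists>a. to_fract d * x = to_fract a"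
    using finite_common_denominator[of "(\<lambda>(l, j). H $$ (l, j)) ` ({..<n} \<times> {..<k})"] by auto
  then have "\<forall>l j. \<exists>a. l < n \<longrightarrow> j < k \<longrightarrow> to_fract d * H $$ (l, j) = to_fract a"
    by fastforce
  then obtain K where K: "to_fract d * H $$ (l, j) = to_fract (K l j)" if "l < n" "j < k" for l j
    by metis
  have *: "(\<Sum>l<n. G $$ (i, l) * K l j) = (if i = j then d else 0)" if ij: "i < k" "j < k" for i j
  proof -
    have "to_fract (\<Sum>l<n. G $$ (i, l) * K l j) = (\<Sum>l<n. to_fract (G $$ (i, l)) * (to_fract d * H $$ (l, j)))"
      using ij by (simp add: K to_fract_sum)
    also have "\<dots> = to_fract d * (\<Sum>l<n. to_fract (G $$ (i, l)) * H $$ (l, j))"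
      by (simp add: sum_distrib_left ac_simps)
    also have "(\<Sum>l<n. to_fract (G $$ (i, l)) * H $$ (l, j)) = (map_mat to_fract G * H) $$ (i, j)"
      using ij G H(1) by (simp add: scalar_prod_def atLeast0LessThan)
    also have "to_fract d * \<dots> = to_fract (if i = j then d else 0)"
      using ij by (simp add: H(2))
    finally show ?thesis by (simp only: to_fract_eq_iff)
  qed
  show thesis by (rule that[of d K, OF d(1) *])
qed

text \<open>If the prime \<open>q\<close> does not divide \<open>w i0\<close>, then Bezout turns \<open>w\<close> into a vector \<open>x\<close> with
  \<open>x i0 = 1\<close> for which \<open>q\<close> still divides the combination of rows. Replacing row \<open>i0\<close> by this
  combination divided by \<open>q\<close> splits off a square factor whose column \<open>i0\<close> is \<open>q\<close> times a unit
  vector; such a factor is not invertible, which contradicts left primeness.\<close>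

lemma left_prime_imp_prime_dvd_coeffs:
  fixes G :: "'f::field_gcd poly mat"
  assumes left_prime: "left_prime G" and G: "G \<in> carrier_mat k n" and q: "prime q"
    and dvd: "\<And>l. l < n \<Longrightarrow> q dvd (\<Sum>i<k. w i * G $$ (i, l))"
    and i0: "i0 < k"
  shows "q dvd w i0"
proof (rule ccontr)
  assume "\<not> q dvd w i0"
  then have "coprime (w i0) q" using prime_imp_coprime[OF q] coprime_commute by blast
  then obtain s t where st: "s * w i0 + t * q = 1"
    using bezout_coefficients_fst_snd[of "w i0" q] by (metis coprime_imp_gcd_eq_1)
  define x where "x i = (if i = i0 then 1 else s * w i)" for i
  have split: "(\<Sum>i<k. f i) = f i0 + (\<Sum>i\<in>{..<k}-{i0}. f i)" for f :: "nat \<Rightarrow> 'f poly"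
    using i0 by (simp add: sum.remove)
  have "q dvd (\<Sum>i<k. x i * G $$ (i, l))" if l: "l < n" for l
  proof -
    have "s * (\<Sum>i<k. w i * G $$ (i, l)) + q * (t * G $$ (i0, l)) =
        (s * w i0 + t * q) * G $$ (i0, l) + (\<Sum>i\<in>{..<k}-{i0}. s * w i * G $$ (i, l))"
      by (simp add: split sum_distrib_left algebra_simps)
    also have "\<dots> = (\<Sum>i<k. x i * G $$ (i, l))"
      unfolding st by (simp add: split x_def)
    finally show ?thesis using dvd_add[OF dvd_mult[OF dvd[OF l], of s] dvd_triv_left[of q "t * G $$ (i0, l)"]] by simp
  qed
  then obtain y where y: "\<And>l. l < n \<Longrightarrow> (\<Sum>i<k. x i * G $$ (i, l)) = q * y l"
    unfolding dvd_def by metis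
  define G' where "G' = mat k n (\<lambda>(i, l). if i = i0 then y l else G $$ (i, l))"
  \<comment> \<open>Row \<open>i0\<close> of \<open>M G'\<close> undoes the replacement: it is \<open>q y\<close> minus the other rows of the combination.\<close>
  define M where "M = mat k k (\<lambda>(i, j). if i = i0 then (if j = i0 then q else - x j)
                                         else if j = i then 1 else 0)"
  have "G = M * G'"
  proof (rule eq_matI)
    fix i l assume "i < dim_row (M * G')" "l < dim_col (M * G')"
    then have il: "i < k" "l < n" by (auto simp: M_def G'_def)
    have "(M * G') $$ (i, l) = (\<Sum>j<k. M $$ (i, j) * G' $$ (j, l))"
      using il by (simp add: M_def G'_def scalar_prod_def atLeast0LessThan)
    also have "\<dots> = G $$ (i, l)"
    proof (cases "i = i0")
      case True
      then have "(\<Sum>j<k. M $$ (i, j) * G' $$ (j, l)) =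
          q * y l - (\<Sum>j\<in>{..<k}-{i0}. x j * G $$ (j, l))"
        using il by (simp add: split M_def G'_def sum_negf[symmetric])
      moreover have "q * y l = G $$ (i0, l) + (\<Sum>j\<in>{..<k}-{i0}. x j * G $$ (j, l))"
        using y[OF il(2)] by (simp add: split x_def)
      ultimately show ?thesis using True by simp
    next
      case False
      then have "(\<Sum>j<k. M $$ (i, j) * G' $$ (j, l)) = (\<Sum>j<k. if j = i then G $$ (i, l) else 0)"
        using il by (intro sum.cong) (auto simp: M_def G'_def)
      then show ?thesis using il by simp
    qed
    finally show "G $$ (i, l) = (M * G') $$ (i, l)" by simp
  qed (use G in \<open>auto simp: M_def G'_def\<close>)
  moreover have "M \<in> carrier_mat k k" "G' \<in> carrier_mat k n" by (auto simp: M_def G'_def)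
  ultimately have "invertible_mat M" using left_prime G by (simp add: left_prime_def)
  then obtain N where N: "inverts_mat M N" "inverts_mat N M"
    by (auto simp: invertible_mat_def)
  have "dim_col N = k"
    using arg_cong[OF N(1)[unfolded inverts_mat_def], of dim_col] by (simp add: M_def)
  moreover have "dim_row N = k"
    using arg_cong[OF N(2)[unfolded inverts_mat_def], of dim_col] by (simp add: M_def)
  ultimately have "(N * M) $$ (i0, i0) = (\<Sum>j<k. N $$ (i0, j) * M $$ (j, i0))"
    using i0 by (simp add: M_def scalar_prod_def atLeast0LessThan)
  also have "\<dots> = N $$ (i0, i0) * q"
    using i0 by (simp add: split M_def)
  finally have "N $$ (i0, i0) * q = 1"
    using N(2) i0 \<open>dim_row N = k\<close> by (simp add: inverts_mat_def)
  then have "is_unit q" by (metis dvd_triv_right)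
  then show False using prime_elem_not_unit[OF prime_imp_prime_elem[OF q]] by blast
qed

lemma left_prime_imp_dvd_coeffs:
  fixes G :: "'f::field_gcd poly mat"
  assumes left_prime: "left_prime G" and G: "G \<in> carrier_mat k n" and "d \<noteq> 0"
    and "\<And>l. l < n \<Longrightarrow> d dvd (\<Sum>i<k. w i * G $$ (i, l))" and "i < k"
  shows "d dvd w i"
  using assms(3-)
proof (induction d arbitrary: w i rule: prime_divisors_induct)
  case zero
  then show ?case by simp
next
  case (unit x)
  then show ?case by (simp add: unit_imp_dvd)
next
  case (factor q d)
  have "q dvd (\<Sum>i<k. w i * G $$ (i, l))" if "l < n" for l
    using factor.prems(2)[OF that] by (rule dvd_mult_left)
  then have "q dvd w i" if "i < k" for i
    using left_prime_imp_prime_dvd_coeffs[OF left_prime G factor.hyps] that by blast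
  then obtain w' where w': "w i = q * w' i" if "i < k" for i
    unfolding dvd_def by metis
  have "d dvd (\<Sum>i<k. w' i * G $$ (i, l))" if "l < n" for l
  proof -
    have "(\<Sum>i<k. w i * G $$ (i, l)) = q * (\<Sum>i<k. w' i * G $$ (i, l))"
      by (simp add: sum_distrib_left w' mult.assoc)
    then show ?thesis using factor.prems(1) factor.prems(2)[OF that] by simp
  qed
  then have "d dvd w' i" using factor.IH[of w' i] factor.prems(1,3) by simp
  then show ?case using w'[OF factor.prems(3)] by simp
qed

text \<open>A pseudo right inverse with denominator \<open>d\<close> shows that \<open>d x\<close> is a polynomial vector \<open>w\<close> with
  \<open>w G\<close> divisible by \<open>d\<close>; by left primeness \<open>d\<close> divides \<open>w\<close> and cancels.\<close>

lemma left_prime_reflects_polynomial: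
  fixes G :: "'f::field_gcd poly mat"
  assumes left_prime: "left_prime G" and G: "G \<in> carrier_mat k n"
    and rank: "vec_space.rank k (map_mat to_fract G) = k"
    and x: "x \<in> carrier_vec k" and poly: "polynomial_vec (encode G x)"
  shows "polynomial_vec x"
proof -
  obtain d K where d: "d \<noteq> 0" and
    K: "\<And>i j. i < k \<Longrightarrow> j < k \<Longrightarrow> (\<Sum>l<n. G $$ (i, l) * K l j) = (if i = j then d else 0)"
    using full_rank_imp_pseudo_right_inverse[OF G rank] by blast
  have "\<forall>l. \<exists>v. l < n \<longrightarrow> encode G x $ l = poly_fls v"
    using poly G by (auto simp: polynomial_vec_def)
  then obtain v where v: "encode G x $ l = poly_fls (v l)" if "l < n" for l by metis
  have enc: "encode G x $ l = (\<Sum>i<k. poly_fls (G $$ (i, l)) * x $ i)" if "l < n" for l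
    using encode_index[of x G l] G x that by simp
  define w where "w j = (\<Sum>l<n. v l * K l j)" for j
  have w: "poly_fls (w j) = poly_fls d * x $ j" if j: "j < k" for j
  proof -
    have "poly_fls (w j) = (\<Sum>l<n. (\<Sum>i<k. poly_fls (G $$ (i, l)) * x $ i) * poly_fls (K l j))"
      by (simp add: w_def poly_fls_sum poly_fls_mult v[symmetric] enc)
    also have "\<dots> = (\<Sum>l<n. \<Sum>i<k. poly_fls (G $$ (i, l) * K l j) * x $ i)"
      by (simp add: sum_distrib_left sum_distrib_right poly_fls_mult ac_simps)
    also have "\<dots> = (\<Sum>i<k. \<Sum>l<n. poly_fls (G $$ (i, l) * K l j) * x $ i)" by (rule sum.swap)
    also have "\<dots> = (\<Sum>i<k. poly_fls (\<Sum>l<n. G $$ (i, l) * K l j) * x $ i)"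
      by (simp add: sum_distrib_right poly_fls_sum)
    also have "\<dots> = (\<Sum>i<k. if i = j then poly_fls d * x $ i else 0)"
      using j by (intro sum.cong) (auto simp: K)
    finally show ?thesis using j by simp
  qed
  have "(\<Sum>i<k. w i * G $$ (i, l)) = d * v l" if l: "l < n" for l
  proof -
    have "poly_fls (\<Sum>i<k. w i * G $$ (i, l)) = poly_fls d * (\<Sum>i<k. poly_fls (G $$ (i, l)) * x $ i)"
      by (simp add: poly_fls_sum poly_fls_mult w sum_distrib_left ac_simps)
    then have "poly_fls (\<Sum>i<k. w i * G $$ (i, l)) = poly_fls (d * v l)"
      by (simp add: poly_fls_mult v[OF l, symmetric] enc[OF l])
    then show ?thesis by (simp only: poly_fls_inject)
  qed
  then have dvd: "d dvd w i" if "i < k" for i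
    using left_prime_imp_dvd_coeffs[OF left_prime G d, of w i] that by simp
  show ?thesis unfolding polynomial_vec_def
  proof (intro allI impI)
    fix i assume "i < dim_vec x"
    then have i: "i < k" using x by simp
    obtain w' where w': "w i = d * w'" using dvd[OF i] by (auto simp: dvd_def)
    then have "poly_fls d * x $ i = poly_fls d * poly_fls w'" 
      using w[OF i, symmetric] by (simp only: w' poly_fls_mult)
    moreover have "poly_fls d \<noteq> 0" using d poly_fls_inject[of d 0] by simp
    ultimately have "x $ i = poly_fls w'" using mult_left_cancel by blast
    then show "x $ i \<in> range poly_fls" by blast
  qed
qed

text \<open>If \<open>x\<close> vanishes before \<open>a\<close>, the coefficient of its word at \<open>a\<close> is that of \<open>x\<close> at \<open>a\<close>
  times \<open>G(0)\<close>. So vanishing of the word pushes the start of \<open>x\<close> up, one step at a time.\<close>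

lemma constant_term_injective_imp_delay_free:
  fixes G :: "'f::field poly mat"
  assumes G: "G \<in> carrier_mat k n"
    and inj: "\<And>c. (\<And>l. l < n \<Longrightarrow> (\<Sum>i<k. c i * poly.coeff (G $$ (i, l)) 0) = 0) \<Longrightarrow> \<forall>i<k. c i = 0"
    and x: "x \<in> carrier_vec k" and supp: "supported_from N (encode G x)"
  shows "supported_from N x"
proof -
  define P where "P a \<longleftrightarrow> (\<forall>i<k. \<forall>m<a. fls_nth (x $ i) m = 0)" for a :: int
  \<comment> \<open>All entries vanish before \<open>b\<close>, and \<open>b \<le> N\<close>, so the induction up to \<open>N\<close> can start at \<open>b\<close>.\<close>
  define b where "b = Min (insert N ((\<lambda>i. fls_subdegree (x $ i)) ` {..<k}))"
  have step: "P (a + 1)" if a: "P a" "a < N" for a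
  proof -
    have "(\<Sum>i<k. fls_nth (x $ i) a * poly.coeff (G $$ (i, l)) 0) = 0" if l: "l < n" for l
    proof -
      have "fls_nth (poly_fls (G $$ (i, l)) * x $ i) a = poly.coeff (G $$ (i, l)) 0 * fls_nth (x $ i) a"
        if i: "i < k" for i
      proof -
        have "fls_nth (poly_fls (G $$ (i, l)) * x $ i) a =
            (\<Sum>s\<le>degree (G $$ (i, l)). if s = 0 then poly.coeff (G $$ (i, l)) 0 * fls_nth (x $ i) a else 0)"
          unfolding fls_nth_poly_fls_mult[OF order.refl]
          using a i by (intro sum.cong) (auto simp: P_def)
        then show ?thesis by simp
      qed
      then have "(\<Sum>i<k. fls_nth (x $ i) a * poly.coeff (G $$ (i, l)) 0) = fls_nth (encode G x $ l) a"
        using x G l by (simp add: encode_index fls_nth_sum mult.commute)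
      then show ?thesis using supp a l G by (simp add: supported_from_def)
    qed
    then have z: "\<forall>i<k. fls_nth (x $ i) a = 0" by (rule inj)
    show ?thesis unfolding P_def
    proof (intro allI impI)
      fix i m assume "i < k" "m < a + 1"
      then show "fls_nth (x $ i) m = 0"
        using a(1) z by (cases "m = a") (simp_all add: P_def)
    qed
  qed
  have "P b" unfolding P_def
  proof (intro allI impI)
    fix i m assume im: "i < k" "m < b"
    have "b \<le> fls_subdegree (x $ i)" using im(1) by (simp add: b_def)
    then show "fls_nth (x $ i) m = 0" using im(2) by (intro fls_eq0_below_subdegree) linarith
  qed
  have "a \<le> N \<longrightarrow> P a" if "b \<le> a" for a
    using that \<open>P b\<close> step by (induction a rule: int_ge_induct) auto
  moreover have "b \<le> N" by (simp add: b_def)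
  ultimately have "P N" by simp
  then show ?thesis using x by (simp add: P_def supported_from_def)
qed

text \<open>This is divisibility by \<open>D\<close> for a constant vector.\<close>

lemma left_prime_imp_constant_term_injective:
  fixes G :: "'f::field_gcd poly mat"
  assumes left_prime: "left_prime G" and G: "G \<in> carrier_mat k n"
    and zero: "\<And>l. l < n \<Longrightarrow> (\<Sum>i<k. c i * poly.coeff (G $$ (i, l)) 0) = 0"
  shows "\<forall>i<k. c i = 0"
proof (intro allI impI)
  fix i assume i: "i < k"
  have D: "[:0, 1:] dvd f \<longleftrightarrow> poly.coeff f 0 = 0" for f :: "'f poly"
    using poly_eq_0_iff_dvd[of f 0] by (simp add: poly_0_coeff_0)
  have "[:0, 1:] dvd (\<Sum>i<k. [:c i:] * G $$ (i, l))" if "l < n" for l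
    using zero[OF that] by (simp add: D coeff_sum)
  then have "[:0, 1:] dvd [:c i:]"
    by (intro left_prime_imp_dvd_coeffs[OF left_prime G _ _ i, of "[:0, 1:]" "\<lambda>i. [:c i:]"]) auto
  then show "c i = 0" by (simp add: D)
qed

lemma full_rank_imp_left_injective:
  fixes A :: "'a::field mat"
  assumes A: "A \<in> carrier_mat k n" and rank: "vec_space.rank k A = k"
    and zero: "\<And>l. l < n \<Longrightarrow> (\<Sum>i<k. c i * A $$ (i, l)) = 0"
  shows "\<forall>i<k. c i = 0"
proof (intro allI impI)
  fix j assume j: "j < k"
  obtain H where H: "H \<in> carrier_mat n k" "A * H = 1\<^sub>m k"
    using full_rank_imp_right_inverse[OF A rank] by auto
  have "c j = (\<Sum>i<k. c i * (if i = j then 1 else 0))"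
    using j by (simp add: if_distrib[of "\<lambda>x. _ * x"] cong: if_cong)
  also have "\<dots> = (\<Sum>i<k. c i * (A * H) $$ (i, j))" using j by (simp add: H(2))
  also have "\<dots> = (\<Sum>i<k. \<Sum>l<n. c i * A $$ (i, l) * H $$ (l, j))"
    using j A H(1) by (simp add: scalar_prod_def atLeast0LessThan sum_distrib_left mult.assoc)
  also have "\<dots> = (\<Sum>l<n. \<Sum>i<k. c i * A $$ (i, l) * H $$ (l, j))" by (rule sum.swap)
  also have "\<dots> = 0" by (simp add: sum_distrib_right[symmetric] zero)
  finally show "c j = 0" .
qed

lemma minimal_basic_encoder_properties:
  fixes G :: "'f::field_gcd poly mat"
  assumes "minimal_basic_encoder n k G C"
  shows "G \<in> carrier_mat k n" and "C = encode G ` carrier_vec k"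
    and "\<And>N x. x \<in> carrier_vec k \<Longrightarrow> supported_from N (encode G x) \<Longrightarrow> supported_from N x"
    and "\<And>x. x \<in> carrier_vec k \<Longrightarrow> polynomial_vec (encode G x) \<Longrightarrow> polynomial_vec x"
    and "\<And>c. (\<And>l. l < n \<Longrightarrow> (\<Sum>i<k. c i * leading_mat G $$ (i, l)) = 0) \<Longrightarrow> \<forall>i<k. c i = 0"
proof -
  have G: "G \<in> carrier_mat k n" and rank: "vec_space.rank k (map_mat to_fract G) = k"
    and lp: "left_prime G" and lead: "vec_space.rank k (leading_mat G) = k"
    using assms by (simp_all add: minimal_basic_encoder_def field_encoder_def)
  show "G \<in> carrier_mat k n" by fact
  show "C = encode G ` carrier_vec k"
    using assms by (simp add: minimal_basic_encoder_def field_encoder_def)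
  show "supported_from N x" if "x \<in> carrier_vec k" "supported_from N (encode G x)" for N x
    by (rule constant_term_injective_imp_delay_free[OF G _ that])
       (rule left_prime_imp_constant_term_injective[OF lp G])
  show "polynomial_vec x" if "x \<in> carrier_vec k" "polynomial_vec (encode G x)" for x
    using left_prime_reflects_polynomial[OF lp G rank that] .
  show "\<forall>i<k. c i = 0" if "\<And>l. l < n \<Longrightarrow> (\<Sum>i<k. c i * leading_mat G $$ (i, l)) = 0" for c
    using G by (intro full_rank_imp_left_injective[OF _ lead that]) (auto simp: leading_mat_def)
qed


section \<open>Lifting residues modulo a prime to digits\<close>

definition map_fls :: "('a::zero \<Rightarrow> 'b::zero) \<Rightarrow> 'a fls \<Rightarrow> 'b fls" where
  "map_fls f x = Abs_fls (\<lambda>m. f (fls_nth x m))"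

lemma fls_nth_map_fls [simp]:
  assumes "f 0 = 0"
  shows "fls_nth (map_fls f x) m = f (fls_nth x m)"
  unfolding map_fls_def using assms
  by (intro nth_Abs_fls_lower_bound[of "fls_subdegree x"] allI impI) (simp add: fls_eq0_below_subdegree)

lemma to_int_mod_ring_bounds:
  fixes x :: "'a::finite mod_ring"
  shows "0 \<le> to_int_mod_ring x" and "to_int_mod_ring x < int CARD('a)"
  using range_to_int_mod_ring[where ?'a = 'a] by auto

lemma to_int_mod_ring_of_int:
  "to_int_mod_ring (of_int z :: 'a::nontriv mod_ring) = z mod int CARD('a)"
  unfolding of_int_of_int_mod_ring by transfer simp

lemma to_int_mod_ring_add:
  "to_int_mod_ring (x + y) = (to_int_mod_ring x + to_int_mod_ring y) mod int CARD('a)"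
  for x y :: "'a::finite mod_ring"
  by transfer simp

lemma to_int_mod_ring_mult:
  "to_int_mod_ring (x * y) = (to_int_mod_ring x * to_int_mod_ring y) mod int CARD('a)"
  for x y :: "'a::finite mod_ring"
  by transfer simp

lemma of_int_mod_ring_eq_0_iff:
  "(of_int z :: 'a::nontriv mod_ring) = 0 \<longleftrightarrow> int CARD('a) dvd z"
proof -
  have "(of_int z :: 'a mod_ring) = 0 \<longleftrightarrow> to_int_mod_ring (of_int z :: 'a mod_ring) = 0"
    by (simp add: to_int_mod_ring_hom.hom_0_iff)
  then show ?thesis by (simp add: to_int_mod_ring_of_int dvd_eq_mod_eq_0)
qed

text \<open>The parameter \<open>lift\<close> only abbreviates the map to representatives; fixing it as a parameter ties the
  two residue rings together.\<close>

locale prime_power_lift =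
  fixes p r :: nat and lift :: "'b::prime_card mod_ring \<Rightarrow> 'a::nontriv mod_ring"
  assumes card_b: "CARD('b) = p" and card_a: "CARD('a) = p ^ r"
    and lift_eq: "lift = (\<lambda>x. of_int (to_int_mod_ring x))"
begin

lemma prime_p: "prime p"
  using prime_card[where ?'a = 'b] card_b by simp

lemma r_pos: "r > 0"
  using nontriv[where ?'a = 'a] card_a by (cases r) auto

lemma p_power_r_eq_0: "(of_nat p ^ r :: 'a mod_ring) = 0"
  using of_nat_card_eq_0[where ?'a = 'a] by (simp add: card_a)

lemma p_power_eq_0: "r \<le> e \<Longrightarrow> (of_nat p ^ e :: 'a mod_ring) = 0"
  using p_power_r_eq_0 by (metis le_Suc_ex mult_zero_left power_add)

text \<open>A generator of the socle, the ideal annihilated by \<open>p\<close>. Multiplying by it makes \<open>lift\<close> additive and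
  multiplicative, because it only sees residues modulo \<open>p\<close>.\<close>

definition socle_gen :: "'a mod_ring" where
  "socle_gen = of_nat p ^ (r - 1)"

lemma power_mult_power_eq_socle_gen:
  "e < r \<Longrightarrow> of_nat p ^ (r - 1 - e) * of_nat p ^ e = socle_gen"
  by (simp add: socle_gen_def power_add[symmetric])

lemma socle_of_int_eq_0_iff: "socle_gen * of_int z = 0 \<longleftrightarrow> int p dvd z"
proof -
  have "socle_gen * of_int z = of_int (int p ^ (r - 1) * z)" by (simp add: socle_gen_def)
  also have "\<dots> = 0 \<longleftrightarrow> int p ^ r dvd int p ^ (r - 1) * z"
    unfolding of_int_mod_ring_eq_0_iff by (simp add: card_a)
  also have "int p ^ r = int p ^ (r - 1) * int p"
    using r_pos by (metis Suc_pred' power_Suc2 One_nat_def)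
  also have "int p ^ (r - 1) * int p dvd int p ^ (r - 1) * z \<longleftrightarrow> int p dvd z"
    using prime_gt_0_nat[OF prime_p] by simp
  finally show ?thesis .
qed

lemma socle_of_int_cong:
  assumes "int p dvd y - z"
  shows "socle_gen * of_int y = socle_gen * of_int z"
  using assms socle_of_int_eq_0_iff[of "y - z"] by (simp add: right_diff_distrib)

lemma lift_0 [simp]: "lift 0 = 0"
  by (simp add: lift_eq)

lemma socle_lift_add:
  "socle_gen * lift (x + y) = socle_gen * (lift x + lift y)"
  using socle_of_int_cong[of "to_int_mod_ring (x + y)" "to_int_mod_ring x + to_int_mod_ring y"]
  by (simp add: lift_eq to_int_mod_ring_add card_b mod_eq_dvd_iff[symmetric])

lemma socle_lift_mult:
  "socle_gen * lift (x * y) = socle_gen * (lift x * lift y)"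
  using socle_of_int_cong[of "to_int_mod_ring (x * y)" "to_int_mod_ring x * to_int_mod_ring y"]
  by (simp add: lift_eq to_int_mod_ring_mult card_b mod_eq_dvd_iff[symmetric])

lemma socle_lift_sum:
  "socle_gen * lift (sum f A) = socle_gen * (\<Sum>i\<in>A. lift (f i))"
  by (induction A rule: infinite_finite_induct) (simp_all add: socle_lift_add distrib_left)

lemma socle_lift_eq_0_iff: "socle_gen * lift x = 0 \<longleftrightarrow> x = 0"
proof -
  have "int p dvd to_int_mod_ring x \<longleftrightarrow> to_int_mod_ring x = 0"
    using to_int_mod_ring_bounds[of x] zdvd_not_zless[of "to_int_mod_ring x" "int p"]
    by (auto simp: card_b order.order_iff_strict)
  then show ?thesis
    by (simp add: lift_eq socle_of_int_eq_0_iff to_int_mod_ring_hom.hom_0_iff)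
qed

lemma power_times_lift_eq_0_iff:
  assumes "e < r"
  shows "of_nat p ^ e * lift x = 0 \<longleftrightarrow> x = 0"
proof
  assume "of_nat p ^ e * lift x = 0"
  then have "of_nat p ^ (r - 1 - e) * (of_nat p ^ e * lift x) = 0" by simp
  then have "socle_gen * lift x = 0"
    by (simp only: mult.assoc[symmetric] power_mult_power_eq_socle_gen[OF assms])
  then show "x = 0" by (simp add: socle_lift_eq_0_iff)
qed simp

lemma lift_eq_0_iff: "lift x = 0 \<longleftrightarrow> x = 0"
  using power_times_lift_eq_0_iff[of 0 x] r_pos by simp

lemma lift_in_digits: "lift x \<in> digits p"
proof -
  have "lift x = of_nat (nat (to_int_mod_ring x))"
    using to_int_mod_ring_bounds(1)[of x] by (simp add: lift_eq)
  moreover have "nat (to_int_mod_ring x) < p"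
    using to_int_mod_ring_bounds[of x] by (simp add: card_b nat_less_iff)
  ultimately show ?thesis by (auto simp: digits_def)
qed

lemma lift_of_int: "lift (of_int z) = of_int (z mod int p)"
  by (simp add: lift_eq to_int_mod_ring_of_int card_b)

lemma digits_eq_range_lift: "digits p = range lift"
proof -
  have "of_nat c \<in> range lift" if "c < p" for c
    using lift_of_int[of "int c"] that by (metis of_int_of_nat_eq rangeI zmod_int mod_less)
  then show ?thesis using lift_in_digits by (auto simp: digits_def)
qed

lemma zero_in_digits [simp]: "(0 :: 'a mod_ring) \<in> digits p"
  using lift_in_digits[of 0] by simp

text \<open>The inverse of \<open>lift\<close> on digits. The value at 0 is fixed so that \<open>digit_of\<close> acts coefficientwise
  on Laurent series.\<close>

definition digit_of :: "'a mod_ring \<Rightarrow> 'b mod_ring" where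
  "digit_of d = (if d = 0 then 0 else inv_into UNIV lift d)"

lemma digit_of_0 [simp]: "digit_of 0 = 0"
  by (simp add: digit_of_def)

lemma lift_digit_of: "d \<in> digits p \<Longrightarrow> lift (digit_of d) = d"
  by (simp add: digit_of_def digits_eq_range_lift f_inv_into_f)

text \<open>Split off the lowest digit of \<open>c\<close> and recurse with the next power of \<open>p\<close>; the recursion ends
  because \<open>p ^ r = 0\<close>.\<close>

lemma digit_expansion:
  assumes "s \<le> r"
  shows "\<exists>d :: nat \<Rightarrow> 'b mod_ring. of_nat p ^ s * c = (\<Sum>e=s..<r. of_nat p ^ e * lift (d e))"
  using assms
proof (induction s arbitrary: c rule: inc_induct)
  case base
  then show ?case by (simp add: p_power_r_eq_0)
next
  case (step s)
  define z where "z = to_int_mod_ring c"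
  have "c = of_int (z mod int p + int p * (z div int p))"
    by (simp add: z_def of_int_of_int_mod_ring)
  then have c: "c = lift (of_int z) + of_nat p * of_int (z div int p)"
    unfolding lift_of_int by (simp only: of_int_add of_int_mult of_int_of_nat_eq)
  obtain d :: "nat \<Rightarrow> 'b mod_ring" where
    d: "of_nat p ^ Suc s * of_int (z div int p) = (\<Sum>e=Suc s..<r. of_nat p ^ e * lift (d e))"
    using step.IH by blast
  have "of_nat p ^ s * c = of_nat p ^ s * lift (of_int z) + of_nat p ^ Suc s * of_int (z div int p)"
    by (subst c) (simp add: algebra_simps)
  also have "\<dots> = (\<Sum>e=s..<r. of_nat p ^ e * lift ((d(s := of_int z)) e))"
    unfolding d using step.hyps by (simp add: sum.atLeast_Suc_lessThan)
  finally show ?case by blast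
qed

lemma lift_poly_mult_lift_fls:
  "fls_const (socle_gen) * (poly_fls (map_poly lift f) * map_fls lift x) =
   fls_const (socle_gen) * map_fls lift (poly_fls f * x)"
proof (rule fls_eqI)
  fix m
  have deg: "degree (map_poly lift f) \<le> degree f" by (rule map_poly_degree_leq)
  have "fls_nth (fls_const (socle_gen) * (poly_fls (map_poly lift f) * map_fls lift x)) m =
     (\<Sum>t\<le>degree f. socle_gen * (lift (poly.coeff f t) * lift (fls_nth x (m - int t))))"
    by (simp add: fls_nth_poly_fls_mult[OF deg] coeff_map_poly sum_distrib_left)
  also have "\<dots> = socle_gen * lift (\<Sum>t\<le>degree f. poly.coeff f t * fls_nth x (m - int t))"
    by (simp add: socle_lift_sum sum_distrib_left socle_lift_mult)
  finally show "fls_nth (fls_const (socle_gen) * (poly_fls (map_poly lift f) * map_fls lift x)) m =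
      fls_nth (fls_const (socle_gen) * map_fls lift (poly_fls f * x)) m"
    by (simp add: fls_nth_poly_fls_mult[OF order.refl])
qed

lemma map_fls_lift_sum:
  "fls_const (socle_gen) * map_fls lift (sum f A) =
   fls_const (socle_gen) * (\<Sum>i\<in>A. map_fls lift (f i))"
  by (intro fls_eqI) (simp add: fls_nth_sum socle_lift_sum)

end

section \<open>Supports and window weights\<close>

definition support :: "'a::zero fls \<Rightarrow> int set" where
  "support x = {m. fls_nth x m \<noteq> 0}"

text \<open>The classes of supports for which reflection passes from the field encoder to the block encoder.
  The closure properties are those needed to subtract words of lower layers: subsets and unions for
  sums, and the shift by one for multiplication by polynomials.\<close>

definition support_ideal :: "int set set \<Rightarrow> bool" where
  "support_ideal I \<longleftrightarrow> {} \<in> I \<and> (\<forall>S\<in>I. \<forall>T. T \<subseteq> S \<longrightarrow> T \<in> I) \<and>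
     (\<forall>S\<in>I. \<forall>T\<in>I. S \<union> T \<in> I) \<and> (\<forall>S\<in>I. (\<lambda>m. m + 1) ` S \<in> I)"

lemma support_ideal_atLeast: "support_ideal {S. S \<subseteq> {N..}}"
  unfolding support_ideal_def by auto

lemma support_ideal_polynomial: "support_ideal {S. finite S \<and> S \<subseteq> {0..}}"
  unfolding support_ideal_def by (auto dest: finite_subset)

lemma support_ideal_mono: "support_ideal I \<Longrightarrow> S \<in> I \<Longrightarrow> T \<subseteq> S \<Longrightarrow> T \<in> I"
  and support_ideal_Un: "support_ideal I \<Longrightarrow> S \<in> I \<Longrightarrow> T \<in> I \<Longrightarrow> S \<union> T \<in> I"
  and support_ideal_empty: "support_ideal I \<Longrightarrow> {} \<in> I"
  by (simp_all add: support_ideal_def)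

lemma support_ideal_UN:
  assumes "support_ideal I" "finite A" "\<And>i. i \<in> A \<Longrightarrow> S i \<in> I"
  shows "(\<Union>i\<in>A. S i) \<in> I"
  using assms(2,3) by (induction A rule: finite_induct) (auto intro: assms(1) support_ideal_Un support_ideal_empty)

lemma support_0 [simp]: "support 0 = {}"
  by (simp add: support_def)

lemma support_add_in_ideal:
  assumes "support_ideal I" "support x \<in> I" "support y \<in> I"
  shows "support (x + y) \<in> I"
  by (rule support_ideal_mono[OF assms(1) support_ideal_Un[OF assms]]) (auto simp: support_def)

lemma support_sum_in_ideal:
  assumes "support_ideal I" "\<And>i. i \<in> A \<Longrightarrow> support (f i) \<in> I"
  shows "support (sum f A) \<in> I"
  using assms(2)
  by (induction A rule: infinite_finite_induct)
     (simp_all add: support_add_in_ideal[OF assms(1)] support_ideal_empty[OF assms(1)])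

lemma support_const_mult_in_ideal:
  fixes x :: "'a::comm_ring_1 fls"
  assumes "support_ideal I" "support x \<in> I"
  shows "support (fls_const c * x) \<in> I"
  by (rule support_ideal_mono[OF assms]) (auto simp: support_def)

lemma support_poly_mult_in_ideal:
  fixes x :: "'a::comm_ring_1 fls"
  assumes I: "support_ideal I" and x: "support x \<in> I"
  shows "support (poly_fls f * x) \<in> I"
proof (induction f)
  case 0
  then show ?case using I by (simp add: support_ideal_empty)
next
  case (pCons a f)
  have "m \<in> support (fls_X * y) \<longleftrightarrow> m \<in> (\<lambda>m. m + 1) ` support y" for m and y :: "'a fls"
  proof
    assume "m \<in> support (fls_X * y)"
    then have "m - 1 \<in> support y" by (simp add: support_def fls_nth_X_mult)
    then show "m \<in> (\<lambda>m. m + 1) ` support y" by (rule image_eqI[rotated]) simp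
  qed (auto simp: support_def fls_nth_X_mult)
  then have "support (fls_X * y) = (\<lambda>m. m + 1) ` support y" for y :: "'a fls" by blast
  then have "support (fls_X * (poly_fls f * x)) \<in> I"
    using I pCons.IH by (simp add: support_ideal_def)
  then show ?case
    using support_add_in_ideal[OF I support_const_mult_in_ideal[OF I x]]
    by (simp add: poly_fls_pCons distrib_right mult.assoc)
qed

lemma supported_from_iff: "supported_from N v \<longleftrightarrow> (\<forall>i<dim_vec v. support (v $ i) \<subseteq> {N..})"
  by (auto simp: supported_from_def support_def subset_eq) (meson not_le)+

lemma range_poly_fls_iff: "x \<in> range poly_fls \<longleftrightarrow> finite (support x) \<and> support x \<subseteq> {0..}"
proof
  assume "x \<in> range poly_fls"
  then obtain f where f: "x = poly_fls f" by blast
  have "support x \<subseteq> {0..int (degree f)}"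
    using le_degree[of f] by (fastforce simp: f support_def fls_nth_poly_fls split: if_splits)
  then show "finite (support x) \<and> support x \<subseteq> {0..}"
    using finite_subset[of _ "{0..int (degree f)}"] by auto
next
  assume *: "finite (support x) \<and> support x \<subseteq> {0..}"
  define f where "f = Abs_poly (\<lambda>i. fls_nth x (int i))"
  have "finite (int -` support x)" using * by (intro finite_vimageI) auto
  then have "\<forall>\<^sub>\<infinity>i. fls_nth x (int i) = 0"
    by (simp add: support_def vimage_def eventually_cofinite)
  then have "poly.coeff f = (\<lambda>i. fls_nth x (int i))"
    unfolding f_def by (intro Abs_poly_inverse) simp
  then have "x = poly_fls f"
    using * by (intro fls_eqI) (auto simp: fls_nth_poly_fls support_def subset_eq)
  then show "x \<in> range poly_fls" by blast
qed

lemma polynomial_vec_iff: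
  "polynomial_vec v \<longleftrightarrow> (\<forall>i<dim_vec v. support (v $ i) \<in> {S. finite S \<and> S \<subseteq> {0..}})"
  by (simp add: polynomial_vec_def range_poly_fls_iff)

lemma supported_from_mono: "supported_from N v \<Longrightarrow> M \<le> N \<Longrightarrow> supported_from M v"
  by (auto simp: supported_from_def)

lemma finite_window: "finite {(i, m). i < d \<and> m \<in> {a..b::int} \<and> P i m}" for d :: nat
  by (rule finite_subset[of _ "{..<d} \<times> {a..b}"]) auto

definition window_weight :: "int \<Rightarrow> int \<Rightarrow> 'a::zero fls vec \<Rightarrow> nat" where
  "window_weight a b v = card {(i, m). i < dim_vec v \<and> m \<in> {a..b} \<and> fls_nth (v $ i) m \<noteq> 0}"

lemma truncated_weight_eq: "truncated_weight j v = window_weight 0 (int j) v"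
  by (simp add: truncated_weight_def window_weight_def)

lemma window_weight_split:
  assumes "a \<le> t" "t \<le> b + 1"
  shows "window_weight a b v = window_weight a (t - 1) v + window_weight t b v"
proof -
  have eq: "{(i, m). i < dim_vec v \<and> m \<in> {a..b} \<and> fls_nth (v $ i) m \<noteq> 0} =
     {(i, m). i < dim_vec v \<and> m \<in> {a..t - 1} \<and> fls_nth (v $ i) m \<noteq> 0} \<union>
     {(i, m). i < dim_vec v \<and> m \<in> {t..b} \<and> fls_nth (v $ i) m \<noteq> 0}"
    using assms by auto
  show ?thesis unfolding window_weight_def eq
    by (rule card_Un_disjoint[OF finite_window finite_window]) auto
qed

lemma window_weight_mono:
  assumes "dim_vec v = dim_vec w"
    and "\<And>i m. i < dim_vec v \<Longrightarrow> a \<le> m \<Longrightarrow> m \<le> b \<Longrightarrow> fls_nth (v $ i) m \<noteq> 0 \<Longrightarrow> fls_nth (w $ i) m \<noteq> 0"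
  shows "window_weight a b v \<le> window_weight a b w"
  unfolding window_weight_def using assms by (intro card_mono finite_window) auto

lemma window_weight_shift:
  "window_weight a b (vec d (\<lambda>i. fls_shift t (v i))) = window_weight (a + t) (b + t) (vec d v)"
  unfolding window_weight_def
  by (rule bij_betw_same_card[of "\<lambda>(i, m). (i, m + t)"],
      rule bij_betw_byWitness[where f' = "\<lambda>(i, m). (i, m - t)"]) auto

lemma encode_shift:
  assumes "x \<in> carrier_vec (dim_row G)"
  shows "encode G (vec (dim_row G) (\<lambda>i. fls_shift t (x $ i))) =
     vec (dim_col G) (\<lambda>l. fls_shift t (encode G x $ l))"
  using assms
  by (intro eq_vecI fls_eqI)
     (simp_all add: encode_index fls_nth_sum fls_nth_poly_fls_mult[OF order.refl] diff_add_eq)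

text \<open>Shifting the input to time 0 moves the window \<open>[t, t + j]\<close> to \<open>[0, j]\<close>, where the column
  distance applies.\<close>

lemma window_weight_ge:
  fixes G :: "'a::comm_ring_1 poly mat"
  assumes dist: "\<And>y. y \<in> carrier_vec (dim_row G) \<Longrightarrow> starts_at_zero y \<Longrightarrow>
      w \<le> truncated_weight j (encode G y)"
    and x: "x \<in> carrier_vec (dim_row G)" and supp: "supported_from t x"
    and start: "\<exists>i<dim_row G. fls_nth (x $ i) t \<noteq> 0"
  shows "w \<le> window_weight t (t + int j) (encode G x)"
proof -
  let ?y = "vec (dim_row G) (\<lambda>i. fls_shift t (x $ i))"
  have "starts_at_zero ?y" using supp start x by (auto simp: starts_at_zero_def supported_from_def)
  then have "w \<le> truncated_weight j (encode G ?y)" using dist by simp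
  also have "\<dots> = window_weight t (t + int j) (vec (dim_col G) (\<lambda>l. encode G x $ l))"
    by (simp add: truncated_weight_eq encode_shift[OF x] window_weight_shift add.commute)
  also have "vec (dim_col G) (\<lambda>l. encode G x $ l) = encode G x" by (intro eq_vecI) auto
  finally show ?thesis .
qed

section \<open>Layers of the block encoder\<close>

lemma poly_fls_of_nat_power:
  "poly_fls (of_nat c ^ e) = fls_const ((of_nat c :: 'a::comm_ring_1) ^ e)"
proof -
  have "(of_nat c ^ e :: 'a poly) = [:of_nat c ^ e:]"
    by (simp add: of_nat_poly poly_const_pow)
  then show ?thesis by (simp add: poly_fls_pCons)
qed

lemma fls_const_mult_assoc: "fls_const a * (fls_const b * x) = fls_const (a * b) * x"
  for a b :: "'a::comm_ring_1"
  by (simp add: mult.assoc[symmetric])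

text \<open>The field encoder is an arbitrary matrix of the right size, because the construction is used twice:
  for the encoder itself and for its matrix of leading coefficients.\<close>

locale block_code = prime_power_lift p r lift
  for p r :: nat and lift :: "'b::prime_card mod_ring \<Rightarrow> 'a::nontriv mod_ring" +
  fixes n k kt :: nat and Gt :: "'b mod_ring poly mat"
  assumes kt_eq: "kt = (if r dvd k then k div r else Suc (k div r))"
    and Gt: "Gt \<in> carrier_mat kt n"
begin

text \<open>Row \<open>i\<close> of the block encoder is \<open>p ^ row_exp i\<close> times the lift of row \<open>base_row i\<close>. The
  exponents that occur with row \<open>b\<close> run from \<open>first_exp b\<close> to \<open>r - 1\<close>, and \<open>row_index\<close> is the
  inverse of this numbering.\<close>

definition first_exp :: "nat \<Rightarrow> nat" where
  "first_exp b = (if b < k div r then 0 else r - k mod r)"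

definition base_row :: "nat \<Rightarrow> nat" where
  "base_row i = (if i < k div r * r then i mod (k div r) else k div r)"

definition row_exp :: "nat \<Rightarrow> nat" where
  "row_exp i = (if i < k div r * r then i div (k div r) else r - k mod r + (i - k div r * r))"

definition row_index :: "nat \<Rightarrow> nat \<Rightarrow> nat" where
  "row_index b e = (if b < k div r then e * (k div r) + b else k div r * r + (e - (r - k mod r)))"

abbreviation G :: "'a mod_ring poly mat" where
  "G \<equiv> block_encoder p r n k Gt"

lemma k_mod_less: "k mod r < r"
  using r_pos by simp

lemma k_split: "k = k div r * r + k mod r"
  by simp

lemma row_decomposition:
  assumes "i < k"
  shows "base_row i < kt" "first_exp (base_row i) \<le> row_exp i" "row_exp i < r"
    "row_index (base_row i) (row_exp i) = i"
proof -
  have "base_row i < kt \<and> first_exp (base_row i) \<le> row_exp i \<and> row_exp i < r \<and>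
    row_index (base_row i) (row_exp i) = i"
  proof (cases "i < k div r * r")
    case True
    then have "k div r > 0" by (cases "k div r") auto
    moreover have "i div (k div r) < r" using True by (simp add: less_mult_imp_div_less mult.commute)
    moreover have "i div (k div r) * (k div r) + i mod (k div r) = i" by (rule div_mult_mod_eq)
    ultimately show ?thesis
      using True by (simp add: base_row_def row_exp_def row_index_def first_exp_def kt_eq less_Suc_eq)
  next
    case False
    then obtain d where d: "i = k div r * r + d" by (metis le_Suc_ex not_less)
    then have "d < k mod r" using assms k_split by linarith
    then have "\<not> r dvd k" by (auto simp: dvd_eq_mod_eq_0)
    moreover have "base_row i = k div r" "row_exp i = r - k mod r + d"
      by (simp_all add: base_row_def row_exp_def d)
    ultimately show ?thesis
      using \<open>d < k mod r\<close> k_mod_less by (simp add: row_index_def first_exp_def kt_eq d) linarith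
  qed
  then show "base_row i < kt" "first_exp (base_row i) \<le> row_exp i" "row_exp i < r"
    "row_index (base_row i) (row_exp i) = i" by auto
qed

lemma row_index:
  assumes "b < kt" "first_exp b \<le> e" "e < r"
  shows "row_index b e < k" "base_row (row_index b e) = b" "row_exp (row_index b e) = e"
proof -
  have "row_index b e < k \<and> base_row (row_index b e) = b \<and> row_exp (row_index b e) = e"
  proof (cases "b < k div r")
    case True
    have "e * (k div r) + b < e * (k div r) + k div r" using True by simp
    also have "\<dots> = Suc e * (k div r)" by simp
    also have "\<dots> \<le> r * (k div r)" using assms(3) by (intro mult_le_mono1) simp
    finally have "e * (k div r) + b < k div r * r" by (simp add: mult.commute)
    moreover from this have "e * (k div r) + b < k" using k_split by linarith
    ultimately show ?thesis
      using True by (simp add: base_row_def row_exp_def row_index_def)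
  next
    case False
    then have b: "b = k div r" and "\<not> r dvd k" using assms(1) by (auto simp: kt_eq split: if_splits)
    have "r - k mod r \<le> e" using assms(2) b by (simp add: first_exp_def)
    then have "e - (r - k mod r) < k mod r" using assms(3) k_mod_less by linarith
    then have "k div r * r + (e - (r - k mod r)) < k" using k_split by linarith
    then show ?thesis
      using \<open>r - k mod r \<le> e\<close> by (simp add: b base_row_def row_exp_def row_index_def)
  qed
  then show "row_index b e < k" "base_row (row_index b e) = b" "row_exp (row_index b e) = e" by auto
qed

lemma first_exp_less: "b < kt \<Longrightarrow> first_exp b < r"
  using r_pos k_mod_less by (auto simp: first_exp_def kt_eq dvd_eq_mod_eq_0 split: if_splits)

lemma sum_rows:
  "(\<Sum>i<k. F i) = (\<Sum>b<kt. \<Sum>e=first_exp b..<r. F (row_index b e))"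
proof -
  have "(\<Sum>b<kt. \<Sum>e=first_exp b..<r. F (row_index b e)) =
      (\<Sum>(b, e)\<in>(SIGMA b:{..<kt}. {first_exp b..<r}). F (row_index b e))"
    by (simp add: sum.Sigma)
  also have "\<dots> = (\<Sum>i<k. F i)"
    by (rule sum.reindex_bij_witness[where i = "\<lambda>i. (base_row i, row_exp i)" and j = "\<lambda>(b, e). row_index b e"])
       (auto simp: row_decomposition row_index)
  finally show ?thesis by simp
qed

lemma dim_G [simp]: "dim_row G = k" "dim_col G = n"
  by (simp_all add: block_encoder_def Let_def)

lemma G_carrier: "G \<in> carrier_mat k n"
  by (rule carrier_matI) simp_all

lemma G_index:
  assumes "i < k" "l < n"
  shows "G $$ (i, l) = of_nat p ^ row_exp i * map_poly lift (Gt $$ (base_row i, l))"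
proof -
  have "base_row i < kt" using row_decomposition[OF assms(1)] by simp
  then have "lift_mat Gt $$ (base_row i, l) = map_poly lift (Gt $$ (base_row i, l))"
    using Gt assms(2) by (simp add: lift_mat_def lift_eq)
  then show ?thesis
    using assms
    by (cases "i < k div r * r")
       (simp_all add: block_encoder_def Let_def base_row_def row_exp_def minus_div_mult_eq_mod)
qed

lemma poly_fls_G_index:
  assumes "i < k" "l < n"
  shows "poly_fls (G $$ (i, l)) =
    fls_const (of_nat p ^ row_exp i) * poly_fls (map_poly lift (Gt $$ (base_row i, l)))"
  using assms by (simp add: G_index poly_fls_mult poly_fls_of_nat_power)

lemma encode_G_index:
  assumes "u \<in> carrier_vec k" "l < n"
  shows "encode G u $ l = (\<Sum>b<kt. \<Sum>e=first_exp b..<r.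
    fls_const (of_nat p ^ e) * (poly_fls (map_poly lift (Gt $$ (b, l))) * u $ row_index b e))"
proof -
  have "encode G u $ l = (\<Sum>b<kt. \<Sum>e=first_exp b..<r.
    poly_fls (G $$ (row_index b e, l)) * u $ row_index b e)"
    using assms by (simp add: encode_index sum_rows)
  also have "\<dots> = (\<Sum>b<kt. \<Sum>e=first_exp b..<r.
    fls_const (of_nat p ^ e) * (poly_fls (map_poly lift (Gt $$ (b, l))) * u $ row_index b e))"
    using assms(2) by (intro sum.cong refl) (simp add: poly_fls_G_index row_index mult.assoc)
  finally show ?thesis .
qed

text \<open>The digits of an input that are multiplied by \<open>p ^ e\<close>, read as an input of the field encoder. Where
  the block encoder has no row with this exponent, the entry is 0.\<close>

definition layer :: "'a mod_ring fls vec \<Rightarrow> nat \<Rightarrow> 'b mod_ring fls vec" where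
  "layer u e = vec kt (\<lambda>b. if first_exp b \<le> e then map_fls digit_of (u $ row_index b e) else 0)"

text \<open>The combination of the lifted rows with the lifted entries of \<open>y\<close>. It differs from the lift of
  the field codeword by carries, which the socle generator kills.\<close>

definition lifted_word :: "'b mod_ring fls vec \<Rightarrow> nat \<Rightarrow> 'a mod_ring fls" where
  "lifted_word y l = (\<Sum>b<kt. poly_fls (map_poly lift (Gt $$ (b, l))) * map_fls lift (y $ b))"

lemma layer_carrier: "layer u e \<in> carrier_vec kt"
  by (simp add: layer_def)

lemma map_fls_lift_digit_of:
  assumes "\<And>m. fls_nth x m \<in> digits p"
  shows "map_fls lift (map_fls digit_of x) = x"
  using assms by (intro fls_eqI) (simp add: lift_digit_of)

lemma map_fls_lift_0: "map_fls lift 0 = 0"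
  by (intro fls_eqI) simp

lemma map_fls_lift_layer:
  assumes u: "u \<in> laurent_vecs (digits p) k" and i: "i < k"
  shows "map_fls lift (layer u (row_exp i) $ base_row i) = u $ i"
  using assms row_decomposition[OF i]
  by (simp add: layer_def map_fls_lift_digit_of laurent_vecs_def)

lemma encode_layers:
  assumes u: "u \<in> laurent_vecs (digits p) k" and l: "l < n"
  shows "encode G u $ l = (\<Sum>e<r. fls_const (of_nat p ^ e) * lifted_word (layer u e) l)"
proof -
  let ?g = "\<lambda>b. poly_fls (map_poly lift (Gt $$ (b, l)))"
  have inner: "(\<Sum>e=first_exp b..<r. fls_const (of_nat p ^ e) * (?g b * u $ row_index b e)) =
      (\<Sum>e<r. fls_const (of_nat p ^ e) * (?g b * map_fls lift (layer u e $ b)))" if b: "b < kt" for b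
  proof (rule sum.mono_neutral_cong_left)
    show "\<forall>e\<in>{..<r} - {first_exp b..<r}. fls_const (of_nat p ^ e) * (?g b * map_fls lift (layer u e $ b)) = 0"
      using b by (auto simp: layer_def map_fls_lift_0)
    fix e assume e: "e \<in> {first_exp b..<r}"
    then have "map_fls lift (layer u e $ b) = u $ row_index b e"
      using map_fls_lift_layer[OF u, of "row_index b e"] b row_index[of b e] by simp
    then show "fls_const (of_nat p ^ e) * (?g b * u $ row_index b e) =
        fls_const (of_nat p ^ e) * (?g b * map_fls lift (layer u e $ b))" by simp
  qed auto
  have "encode G u $ l =
      (\<Sum>b<kt. \<Sum>e<r. fls_const (of_nat p ^ e) * (?g b * map_fls lift (layer u e $ b)))"
    using u l inner by (simp add: encode_G_index laurent_vecs_def)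
  also have "\<dots> = (\<Sum>e<r. fls_const (of_nat p ^ e) * lifted_word (layer u e) l)"
    by (subst sum.swap) (simp add: lifted_word_def sum_distrib_left)
  finally show ?thesis .
qed

lemma socle_lifted_word:
  assumes "y \<in> carrier_vec kt" "l < n"
  shows "fls_const socle_gen * lifted_word y l = fls_const socle_gen * map_fls lift (encode Gt y $ l)"
proof -
  have "fls_const socle_gen * lifted_word y l =
     (\<Sum>b<kt. fls_const socle_gen * map_fls lift (poly_fls (Gt $$ (b, l)) * y $ b))"
    by (simp add: lifted_word_def sum_distrib_left lift_poly_mult_lift_fls)
  also have "\<dots> = fls_const socle_gen * map_fls lift (\<Sum>b<kt. poly_fls (Gt $$ (b, l)) * y $ b)"
    by (simp add: map_fls_lift_sum sum_distrib_left)
  finally show ?thesis using assms Gt by (simp add: encode_index)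
qed

lemma support_socle_map_lift: "support (fls_const socle_gen * map_fls lift x) = support x"
  by (simp add: support_def socle_lift_eq_0_iff)

lemma support_map_lift: "support (map_fls lift x) = support x"
  by (simp add: support_def lift_eq_0_iff)

text \<open>The layers above \<open>e\<close> acquire a factor \<open>p ^ r = 0\<close>, and layer \<open>e\<close> acquires the socle
  generator.\<close>

lemma peel_layers:
  assumes u: "u \<in> laurent_vecs (digits p) k" and e: "e < r" and l: "l < n"
  shows "fls_const (of_nat p ^ (r - 1 - e)) * encode G u $ l =
    (\<Sum>e'<e. fls_const (of_nat p ^ (r - 1 - e + e')) * lifted_word (layer u e') l) +
    fls_const socle_gen * map_fls lift (encode Gt (layer u e) $ l)"
proof -
  let ?f = "\<lambda>e'. fls_const (of_nat p ^ (r - 1 - e + e')) * lifted_word (layer u e') l"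
  have "fls_const (of_nat p ^ (r - 1 - e)) * encode G u $ l = (\<Sum>e'<r. ?f e')"
    by (simp add: encode_layers[OF u l] sum_distrib_left fls_const_mult_assoc power_add
        del: fls_const_mult_const)
  also have "\<dots> = (\<Sum>e'<Suc e. ?f e')"
    using e by (intro sum.mono_neutral_right) (auto simp: p_power_eq_0)
  also have "\<dots> = (\<Sum>e'<e. ?f e') + ?f e" by simp
  also have "?f e = fls_const socle_gen * lifted_word (layer u e) l"
    using power_mult_power_eq_socle_gen[OF e] by (simp only: power_add)
  finally show ?thesis by (simp add: socle_lifted_word[OF layer_carrier l])
qed

text \<open>The support \<open>S\<close> accounts for the lower layers in \<open>peel_layers\<close>. It is kept apart from the support
  of the word so that the lemma also applies when only part of the word is controlled.\<close>

lemma layer_word_support: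
  assumes I: "support_ideal I" and u: "u \<in> laurent_vecs (digits p) k" and e: "e < r"
    and lower: "\<And>e' b. e' < e \<Longrightarrow> b < kt \<Longrightarrow> support (layer u e' $ b) \<in> I"
  shows "\<exists>S\<in>I. \<forall>l<n. support (encode Gt (layer u e) $ l) \<subseteq> support (encode G u $ l) \<union> S"
proof (intro bexI allI impI)
  let ?D = "\<lambda>l. \<Sum>e'<e. fls_const (of_nat p ^ (r - 1 - e + e')) * lifted_word (layer u e') l"
  have D: "support (?D l) \<in> I" for l
    unfolding lifted_word_def using lower
    by (intro support_sum_in_ideal[OF I] support_const_mult_in_ideal[OF I]
        support_poly_mult_in_ideal[OF I]) (simp add: support_map_lift)
  show "(\<Union>l\<in>{..<n}. support (?D l)) \<in> I" by (rule support_ideal_UN[OF I]) (use D in auto)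
  fix l assume l: "l < n"
  have "support (encode Gt (layer u e) $ l) =
      support (fls_const (of_nat p ^ (r - 1 - e)) * encode G u $ l - ?D l)"
    unfolding peel_layers[OF u e l] by (simp add: support_socle_map_lift)
  also have "\<dots> \<subseteq> support (encode G u $ l) \<union> support (?D l)" by (auto simp: support_def)
  also have "\<dots> \<subseteq> support (encode G u $ l) \<union> (\<Union>l\<in>{..<n}. support (?D l))" using l by blast
  finally show "support (encode Gt (layer u e) $ l) \<subseteq>
    support (encode G u $ l) \<union> (\<Union>l\<in>{..<n}. support (?D l))" .
qed

lemma support_row_in_ideal:
  assumes u: "u \<in> laurent_vecs (digits p) k"
    and layers: "\<And>e b. e < r \<Longrightarrow> b < kt \<Longrightarrow> support (layer u e $ b) \<in> I" and i: "i < k"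
  shows "support (u $ i) \<in> I"
  using layers[of "row_exp i" "base_row i"] row_decomposition[OF i]
    support_map_lift[of "layer u (row_exp i) $ base_row i"]
  by (simp add: map_fls_lift_layer[OF u i])

lemma reflects_support:
  assumes I: "support_ideal I"
    and field: "\<And>y. y \<in> carrier_vec kt \<Longrightarrow> (\<And>l. l < n \<Longrightarrow> support (encode Gt y $ l) \<in> I) \<Longrightarrow>
        \<forall>b<kt. support (y $ b) \<in> I"
    and u: "u \<in> laurent_vecs (digits p) k"
    and word: "\<And>l. l < n \<Longrightarrow> support (encode G u $ l) \<in> I" and i: "i < k"
  shows "support (u $ i) \<in> I"
proof -
  have "\<forall>b<kt. support (layer u e $ b) \<in> I" if "e < r" for e
    using that
  proof (induction e rule: less_induct)
    case (less e)
    have lower: "support (layer u e' $ b) \<in> I" if "e' < e" "b < kt" for e' b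
      using less.IH[of e'] less.prems that by simp
    obtain S where S: "S \<in> I"
      "\<And>l. l < n \<Longrightarrow> support (encode Gt (layer u e) $ l) \<subseteq> support (encode G u $ l) \<union> S"
      using layer_word_support[OF I u less.prems lower] by blast
    have "support (encode Gt (layer u e) $ l) \<in> I" if "l < n" for l
      using support_ideal_mono[OF I support_ideal_Un[OF I word[OF that] S(1)] S(2)[OF that]] .
    then show ?case using field layer_carrier by blast
  qed
  then show ?thesis using support_row_in_ideal[OF u _ i] by blast
qed


section \<open>Minimality of the block encoder\<close>

lemma delay_free_G:
  assumes field: "\<And>N y. y \<in> carrier_vec kt \<Longrightarrow> supported_from N (encode Gt y) \<Longrightarrow> supported_from N y"
  shows "delay_free p G"
  unfolding delay_free_def dim_G
proof (intro ballI allI impI)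
  fix u N assume u: "u \<in> laurent_vecs (digits p) k" and supp: "supported_from N (encode G u)"
  have "support (u $ i) \<in> {S. S \<subseteq> {N..}}" if "i < k" for i
  proof (rule reflects_support[OF support_ideal_atLeast _ u _ that])
    show "\<forall>b<kt. support (y $ b) \<in> {S. S \<subseteq> {N..}}"
      if "y \<in> carrier_vec kt" "\<And>l. l < n \<Longrightarrow> support (encode Gt y $ l) \<in> {S. S \<subseteq> {N..}}" for y
      using field[of y N] that Gt by (simp add: supported_from_iff)
    show "support (encode G u $ l) \<in> {S. S \<subseteq> {N..}}" if "l < n" for l
      using supp that by (simp add: supported_from_iff)
  qed
  moreover have "dim_vec u = k" using u by (auto simp: laurent_vecs_def)
  ultimately show "supported_from N u" by (simp add: supported_from_iff)
qed

lemma noncatastrophic_G: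
  assumes field: "\<And>y. y \<in> carrier_vec kt \<Longrightarrow> polynomial_vec (encode Gt y) \<Longrightarrow> polynomial_vec y"
  shows "noncatastrophic p G"
  unfolding noncatastrophic_def dim_G
proof (intro ballI impI)
  fix u assume u: "u \<in> laurent_vecs (digits p) k" and poly: "polynomial_vec (encode G u)"
  let ?I = "{S :: int set. finite S \<and> S \<subseteq> {0..}}"
  have "support (u $ i) \<in> ?I" if "i < k" for i
  proof (rule reflects_support[OF support_ideal_polynomial _ u _ that])
    show "\<forall>b<kt. support (y $ b) \<in> ?I"
      if "y \<in> carrier_vec kt" "\<And>l. l < n \<Longrightarrow> support (encode Gt y $ l) \<in> ?I" for y
      using field[of y] that Gt by (simp add: polynomial_vec_iff)
    show "support (encode G u $ l) \<in> ?I" if "l < n" for l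
      using poly that by (simp add: polynomial_vec_iff)
  qed
  moreover have "dim_vec u = k" using u by (auto simp: laurent_vecs_def)
  ultimately show "polynomial_vec u" by (simp add: polynomial_vec_iff)
qed

text \<open>Multiplying row \<open>(b, e)\<close> by \<open>p\<close> gives row \<open>(b, e + 1)\<close>, which comes later, or 0 if \<open>e = r - 1\<close>.\<close>

lemma p_generator_seq_G: "p_generator_seq p (digit_polys p) G"
  unfolding p_generator_seq_def dim_G
proof (intro allI impI)
  fix i assume i: "i < k"
  let ?b = "base_row i" and ?e = "row_exp i"
  note ri = row_decomposition[OF i]
  have digits: "(0 :: 'a mod_ring poly) \<in> digit_polys p" "(1 :: 'a mod_ring poly) \<in> digit_polys p"
    using prime_gt_1_nat[OF prime_p] by (force simp: digit_polys_def digits_def coeff_1 intro: image_eqI[of _ _ 1] image_eqI[of _ _ 0])+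
  show "\<exists>a. (\<forall>j. a j \<in> digit_polys p) \<and> of_nat p \<cdot>\<^sub>v row G i = comb_rows G {i<..<k} a"
  proof (cases "Suc ?e < r")
    case True
    define j where "j = row_index ?b (Suc ?e)"
    have j: "j < k" "base_row j = ?b" "row_exp j = Suc ?e"
      using row_index[of ?b "Suc ?e"] ri True by (simp_all add: j_def)
    have ij: "i < j"
    proof (cases "i < k div r * r")
      case True
      then have "0 < k div r" by (cases "k div r") auto
      then show ?thesis
        using True ri(4) by (subst ri(4)[symmetric]) (simp add: j_def row_index_def base_row_def)
    next
      case False
      then show ?thesis
        using ri(2) ri(4) by (subst ri(4)[symmetric]) (simp add: j_def row_index_def base_row_def first_exp_def)
    qed
    have "of_nat p \<cdot>\<^sub>v row G i = comb_rows G {i<..<k} (\<lambda>m. if m = j then 1 else 0)"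
    proof (intro eq_vecI)
      fix l assume "l < dim_vec (comb_rows G {i<..<k} (\<lambda>m. if m = j then 1 else 0))"
      then have l: "l < n" by (simp add: comb_rows_def)
      have "(\<Sum>m\<in>{i<..<k}. (if m = j then 1 else 0) * G $$ (m, l)) =
          (\<Sum>m\<in>{i<..<k}. if m = j then G $$ (j, l) else 0)" by (intro sum.cong) auto
      also have "\<dots> = G $$ (j, l)" using ij j(1) by simp
      also have "\<dots> = of_nat p * G $$ (i, l)"
        using i l j by (simp add: G_index mult.assoc)
      finally show "(of_nat p \<cdot>\<^sub>v row G i) $ l = comb_rows G {i<..<k} (\<lambda>m. if m = j then 1 else 0) $ l"
        using i l by (simp add: comb_rows_def)
    qed (simp add: comb_rows_def)
    then show ?thesis
      using digits by (intro exI[of _ "\<lambda>m. if m = j then 1 else 0"]) auto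
  next
    case False
    then have "r \<le> Suc ?e" by simp
    then have zero: "(of_nat p * of_nat p ^ ?e :: 'a mod_ring poly) = 0"
      using p_power_eq_0[of "Suc ?e"] by (simp add: of_nat_poly poly_const_pow flip: power_Suc)
    have "of_nat p \<cdot>\<^sub>v row G i = comb_rows G {i<..<k} (\<lambda>_. 0)"
      using i zero by (intro eq_vecI) (simp_all add: comb_rows_def G_index mult.assoc[symmetric])
    then show ?thesis
      using digits by (intro exI[of _ "\<lambda>_. 0"]) auto
  qed
qed

text \<open>A polynomial input with zero word is supported from every time on, so it is zero.\<close>

lemma p_lin_indep_G:
  assumes "delay_free p G"
  shows "p_lin_indep (digit_polys p) G"
  unfolding p_lin_indep_def dim_G
proof (intro allI impI)
  fix a j assume a: "\<forall>j<k. a j \<in> digit_polys p"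
    and zero: "comb_rows G {..<k} a = 0\<^sub>v n" and j: "j < k"
  let ?u = "vec k (\<lambda>j. poly_fls (a j))"
  have u: "?u \<in> laurent_vecs (digits p) k"
    using a by (simp add: laurent_vecs_def fls_nth_poly_fls digit_polys_def)
  have "encode G ?u $ l = 0" if l: "l < n" for l
  proof -
    have "encode G ?u $ l = poly_fls (comb_rows G {..<k} a $ l)"
      using l by (simp add: encode_index comb_rows_def poly_fls_sum poly_fls_mult mult.commute)
    then show ?thesis using zero l by simp
  qed
  then have "supported_from N (encode G ?u)" for N by (simp add: supported_from_def)
  then have supp: "supported_from N ?u" for N
    using assms u by (simp add: delay_free_def)
  have "fls_nth (poly_fls (a j)) m = 0" for m
    using supp[of "m + 1"] j by (simp add: supported_from_def)
  then have "poly_fls (a j) = poly_fls 0" by (intro fls_eqI) simp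
  then show "a j = 0" by (simp only: poly_fls_inject)
qed

text \<open>The code is generated by the rows of lowest exponent \<open>p ^ first_exp b\<close> alone: the digits of an
  arbitrary coefficient supply the inputs for the multiples of these rows.\<close>

lemma ring_conv_code_G: "ring_conv_code n (encode G ` laurent_vecs (digits p) k)"
proof -
  define M where "M = mat kt n (\<lambda>(b, l). of_nat p ^ first_exp b * map_poly lift (Gt $$ (b, l)))"
  let ?g = "\<lambda>b l. poly_fls (map_poly lift (Gt $$ (b, l)))"
  have dim_M [simp]: "dim_row M = kt" "dim_col M = n" by (simp_all add: M_def)
  have enc_M: "encode M x $ l = (\<Sum>b<kt. ?g b l * (fls_const (of_nat p ^ first_exp b) * x $ b))"
    if "x \<in> carrier_vec kt" "l < n" for x l
    using that by (simp add: encode_index M_def poly_fls_mult poly_fls_of_nat_power ac_simps)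
  have enc_G: "encode G u $ l =
      (\<Sum>b<kt. ?g b l * (\<Sum>e=first_exp b..<r. fls_const (of_nat p ^ e) * u $ row_index b e))"
    if "u \<in> carrier_vec k" "l < n" for u l
    using that by (simp add: encode_G_index sum_distrib_left mult.left_commute)
  have "encode G ` laurent_vecs (digits p) k \<subseteq> encode M ` carrier_vec kt"
  proof (intro subsetI, elim imageE)
    fix v u assume v: "v = encode G u" and "u \<in> laurent_vecs (digits p) k"
    then have u: "u \<in> carrier_vec k" by (simp add: laurent_vecs_def)
    define x where
      "x = vec kt (\<lambda>b. \<Sum>e=first_exp b..<r. fls_const (of_nat p ^ (e - first_exp b)) * u $ row_index b e)"
    have x: "x \<in> carrier_vec kt" by (simp add: x_def)
    have "fls_const (of_nat p ^ first_exp b) * x $ b =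
        (\<Sum>e=first_exp b..<r. fls_const (of_nat p ^ e) * u $ row_index b e)" if "b < kt" for b
      using that
      by (simp add: x_def sum_distrib_left fls_const_mult_assoc power_add[symmetric] del: fls_const_mult_const)
    then have "v = encode M x"
      unfolding v using u x by (intro eq_vecI) (simp_all add: enc_G enc_M)
    then show "v \<in> encode M ` carrier_vec kt" using x by blast
  qed
  moreover have "encode M ` carrier_vec kt \<subseteq> encode G ` laurent_vecs (digits p) k"
  proof (intro subsetI, elim imageE)
    fix v x assume v: "v = encode M x" and x: "x \<in> carrier_vec kt"
    \<comment> \<open>The expansion of 0 is chosen to be 0, so that coefficientwise expansion yields Laurent series.\<close>
    have "\<forall>s c. \<exists>d :: nat \<Rightarrow> 'b mod_ring. s \<le> r \<longrightarrow>
        (of_nat p ^ s * c = (\<Sum>e=s..<r. of_nat p ^ e * lift (d e)) \<and> (c = 0 \<longrightarrow> (\<forall>e. d e = 0)))"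
    proof (intro allI)
      fix s c
      show "\<exists>d :: nat \<Rightarrow> 'b mod_ring. s \<le> r \<longrightarrow>
        (of_nat p ^ s * c = (\<Sum>e=s..<r. of_nat p ^ e * lift (d e)) \<and> (c = 0 \<longrightarrow> (\<forall>e. d e = 0)))"
      proof (cases "c = 0")
        case True
        then show ?thesis by (intro exI[of _ "\<lambda>_. 0"]) simp
      next
        case False
        then show ?thesis using digit_expansion[of s c] by auto
      qed
    qed
    then obtain d :: "nat \<Rightarrow> 'a mod_ring \<Rightarrow> nat \<Rightarrow> 'b mod_ring" where
      d: "s \<le> r \<Longrightarrow> of_nat p ^ s * c = (\<Sum>e=s..<r. of_nat p ^ e * lift (d s c e))"
         "s \<le> r \<Longrightarrow> c = 0 \<Longrightarrow> d s c e = 0" for s c e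
      by metis
    define u where "u = vec k (\<lambda>i. map_fls (\<lambda>c. lift (d (first_exp (base_row i)) c (row_exp i))) (x $ base_row i))"
    have s: "first_exp (base_row i) \<le> r" if "i < k" for i
      using first_exp_less row_decomposition(1)[OF that] by (simp add: less_imp_le)
    have u: "u \<in> laurent_vecs (digits p) k"
      using s d(2) lift_in_digits by (simp add: u_def laurent_vecs_def)
    have "fls_const (of_nat p ^ first_exp b) * x $ b =
        (\<Sum>e=first_exp b..<r. fls_const (of_nat p ^ e) * u $ row_index b e)" if b: "b < kt" for b
    proof (rule fls_eqI)
      fix m
      have s: "first_exp b \<le> r" using first_exp_less[OF b] by simp
      have "fls_nth (u $ row_index b e) m = lift (d (first_exp b) (fls_nth (x $ b) m) e)"
        if "e \<in> {first_exp b..<r}" for e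
        using row_index[of b e] b that s d(2) by (simp add: u_def)
      then show "fls_nth (fls_const (of_nat p ^ first_exp b) * x $ b) m =
          fls_nth (\<Sum>e=first_exp b..<r. fls_const (of_nat p ^ e) * u $ row_index b e) m"
        using d(1)[OF s] by (simp add: fls_nth_sum)
    qed
    then have "v = encode G u"
      unfolding v using u x by (intro eq_vecI) (simp_all add: enc_G enc_M laurent_vecs_def)
    then show "v \<in> encode G ` laurent_vecs (digits p) k" using u by blast
  qed
  ultimately show ?thesis
    unfolding ring_conv_code_def by (intro exI[of _ kt] bexI[of _ M]) (auto intro: carrier_matI)
qed

lemma coeff_G:
  assumes "i < k" "l < n"
  shows "poly.coeff (G $$ (i, l)) m = of_nat p ^ row_exp i * lift (poly.coeff (Gt $$ (base_row i, l)) m)"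
proof -
  have "(of_nat p ^ row_exp i :: 'a mod_ring poly) = [:of_nat p ^ row_exp i:]"
    by (simp add: of_nat_poly poly_const_pow)
  then show ?thesis using assms by (simp add: G_index coeff_map_poly)
qed

lemma degree_G:
  assumes "i < k" "l < n"
  shows "degree (G $$ (i, l)) = degree (Gt $$ (base_row i, l))"
proof -
  have "poly.coeff (G $$ (i, l)) m = 0 \<longleftrightarrow> poly.coeff (Gt $$ (base_row i, l)) m = 0" for m
    using assms row_decomposition(3)[OF assms(1)]
    by (simp add: coeff_G power_times_lift_eq_0_iff)
  then show ?thesis by (simp add: degree_def)
qed

lemma row_degree_G: "i < k \<Longrightarrow> row_degree G i = row_degree Gt (base_row i)"
  using Gt by (simp add: row_degree_def degree_G)

lemma leading_mat_G_index:
  assumes "i < k" "l < n"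
  shows "leading_mat G $$ (i, l) = of_nat p ^ row_exp i * lift (leading_mat Gt $$ (base_row i, l))"
  using assms row_decomposition(1)[OF assms(1)] Gt
  by (simp add: leading_mat_def coeff_G row_degree_G)

text \<open>Lifting preserves degrees and \<open>p ^ e\<close> annihilates no nonzero digit for \<open>e < r\<close>, so taking leading
  coefficients commutes with the block construction.\<close>

lemma leading_mat_G_eq_block_encoder:
  "map_mat (\<lambda>c. [:c:]) (leading_mat G) =
   block_encoder p r n k (map_mat (\<lambda>c. [:c:]) (leading_mat Gt))"
proof -
  interpret L: block_code p r lift n k kt "map_mat (\<lambda>c. [:c:]) (leading_mat Gt)"
    using Gt by unfold_locales (auto simp: kt_eq leading_mat_def)
  show ?thesis
  proof (rule eq_matI)
    fix i l assume "i < dim_row L.G" "l < dim_col L.G"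
    then have il: "i < k" "l < n" by simp_all
    have "(of_nat p ^ row_exp i :: 'a mod_ring poly) = [:of_nat p ^ row_exp i:]"
      by (simp add: of_nat_poly poly_const_pow)
    moreover have "map_mat (\<lambda>c. [:c:]) (leading_mat Gt) $$ (base_row i, l) = [:leading_mat Gt $$ (base_row i, l):]"
      using row_decomposition(1)[OF il(1)] il Gt by (simp add: leading_mat_def)
    moreover have "map_poly lift [:c:] = [:lift c:]" for c
      by (rule poly_eqI) (simp add: coeff_map_poly coeff_pCons split: nat.split)
    moreover have "dim_row (leading_mat G) = k" "dim_col (leading_mat G) = n"
      by (simp_all add: leading_mat_def)
    ultimately show "map_mat (\<lambda>c. [:c:]) (leading_mat G) $$ (i, l) = L.G $$ (i, l)"
      using il by (simp add: L.G_index leading_mat_G_index)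
  qed (simp_all add: leading_mat_def[of G])
qed

text \<open>A constant matrix with injective left multiplication is delay-free, hence so is the block encoder
  built from it.\<close>

lemma p_lin_indep_leading_mat_G:
  assumes inj: "\<And>c. (\<And>l. l < n \<Longrightarrow> (\<Sum>b<kt. c b * leading_mat Gt $$ (b, l)) = 0) \<Longrightarrow> \<forall>b<kt. c b = 0"
  shows "p_lin_indep (digits p) (leading_mat G)"
proof -
  let ?c = "\<lambda>c. [:c:]" and ?Lt = "map_mat (\<lambda>c. [:c:]) (leading_mat Gt)"
  have Lt: "?Lt \<in> carrier_mat kt n" using Gt by (auto simp: leading_mat_def)
  interpret L: block_code p r lift n k kt ?Lt
    using Lt by unfold_locales (simp_all add: kt_eq)
  have "supported_from N y" if "y \<in> carrier_vec kt" "supported_from N (encode ?Lt y)" for N y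
  proof (rule constant_term_injective_imp_delay_free[OF Lt _ that])
    fix c assume "\<And>l. l < n \<Longrightarrow> (\<Sum>i<kt. c i * poly.coeff (?Lt $$ (i, l)) 0) = 0"
    then show "\<forall>i<kt. c i = 0" using Lt by (intro inj) simp
  qed
  then have "p_lin_indep (digit_polys p) L.G"
    by (intro L.p_lin_indep_G L.delay_free_G)
  then have indep: "p_lin_indep (digit_polys p) (map_mat ?c (leading_mat G))"
    by (simp only: leading_mat_G_eq_block_encoder)
  show ?thesis
    unfolding p_lin_indep_def
  proof (intro allI impI)
    fix a j assume a: "\<forall>j<dim_row (leading_mat G). a j \<in> digits p"
      and zero: "comb_rows (leading_mat G) {..<dim_row (leading_mat G)} a = 0\<^sub>v (dim_col (leading_mat G))"
      and j: "j < dim_row (leading_mat G)"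
    have "comb_rows (map_mat ?c (leading_mat G)) {..<dim_row (leading_mat G)} (\<lambda>j. [:a j:]) =
        0\<^sub>v (dim_col (leading_mat G))"
    proof (rule eq_vecI)
      fix l assume "l < dim_vec (0\<^sub>v (dim_col (leading_mat G)) :: 'a mod_ring poly vec)"
      then have l: "l < dim_col (leading_mat G)" by simp
      have hom: "[:\<Sum>j\<in>J. f j:] = (\<Sum>j\<in>J. [:f j:])" for J :: "nat set" and f :: "nat \<Rightarrow> 'a mod_ring"
        by (rule poly_eqI) (simp add: coeff_sum coeff_pCons split: nat.split)
      have "comb_rows (map_mat ?c (leading_mat G)) {..<dim_row (leading_mat G)} (\<lambda>j. [:a j:]) $ l =
          [:comb_rows (leading_mat G) {..<dim_row (leading_mat G)} a $ l:]"
        using l by (simp add: comb_rows_def hom)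
      then show "comb_rows (map_mat ?c (leading_mat G)) {..<dim_row (leading_mat G)} (\<lambda>j. [:a j:]) $ l =
          0\<^sub>v (dim_col (leading_mat G)) $ l"
        using l by (simp add: zero)
    qed (simp add: comb_rows_def)
    moreover have "[:a j:] \<in> digit_polys p" if "j < dim_row (leading_mat G)" for j
      using a that by (auto simp: digit_polys_def coeff_pCons split: nat.splits)
    ultimately have "[:a j:] = 0"
      using indep[unfolded p_lin_indep_def] j by (auto dest!: spec[of _ "\<lambda>j. [:a j:]"])
    then show "a j = 0" by simp
  qed
qed

lemma minimal_p_encoder_G:
  assumes delay: "\<And>N y. y \<in> carrier_vec kt \<Longrightarrow> supported_from N (encode Gt y) \<Longrightarrow> supported_from N y"
    and poly: "\<And>y. y \<in> carrier_vec kt \<Longrightarrow> polynomial_vec (encode Gt y) \<Longrightarrow> polynomial_vec y"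
    and lead: "\<And>c. (\<And>l. l < n \<Longrightarrow> (\<Sum>b<kt. c b * leading_mat Gt $$ (b, l)) = 0) \<Longrightarrow> \<forall>b<kt. c b = 0"
  shows "minimal_p_encoder p n k G (encode G ` laurent_vecs (digits p) k)"
  unfolding minimal_p_encoder_def p_encoder_def reduced_p_basis_def p_basis_def
  using G_carrier p_generator_seq_G p_lin_indep_G delay_free_G[OF delay] noncatastrophic_G[OF poly]
    p_lin_indep_leading_mat_G[OF lead] by blast


section \<open>Column distances of the lifted code\<close>

text \<open>Feeding \<open>y\<close> into the rows of exponent \<open>r - 1\<close>, which exist for every \<open>b\<close>, copies the field
  codeword into the socle.\<close>

lemma socle_word:
  assumes y: "y \<in> carrier_vec kt"
  obtains u where "u \<in> laurent_vecs (digits p) k"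
    and "\<And>l. l < n \<Longrightarrow> support (encode G u $ l) = support (encode Gt y $ l)"
proof
  let ?u = "vec k (\<lambda>i. if row_exp i = r - 1 then map_fls lift (y $ base_row i) else 0)"
  show "?u \<in> laurent_vecs (digits p) k"
    using lift_in_digits by (simp add: laurent_vecs_def)
  fix l assume l: "l < n"
  have "(\<Sum>e=first_exp b..<r. fls_const (of_nat p ^ e) *
        (poly_fls (map_poly lift (Gt $$ (b, l))) * ?u $ row_index b e)) =
      fls_const socle_gen * (poly_fls (map_poly lift (Gt $$ (b, l))) * map_fls lift (y $ b))"
    (is "sum ?f _ = ?w") if b: "b < kt" for b
  proof -
    have "sum ?f {first_exp b..<r} = (\<Sum>e=first_exp b..<r. if e = r - 1 then ?w else 0)"
      using b by (intro sum.cong) (simp_all add: row_index socle_gen_def)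
    also have "\<dots> = ?w" using first_exp_less[OF b] by simp
    finally show ?thesis .
  qed
  then have "encode G ?u $ l = fls_const socle_gen * lifted_word y l"
    using l by (simp add: encode_G_index lifted_word_def sum_distrib_left)
  then show "support (encode G ?u $ l) = support (encode Gt y $ l)"
    using support_socle_map_lift[of "encode Gt y $ l"] by (simp add: socle_lifted_word[OF y l])
qed

text \<open>At the first \<open>j\<close> where the bound fails, every window \<open>[t, j]\<close> carries less weight of the word than
  a field codeword starting at \<open>t\<close> would have there. Once the lower layers are known to start after
  \<open>j\<close>, the socle copy of the field codeword of layer \<open>e\<close> agrees with a multiple of the word up to
  time \<open>j\<close>, so layer \<open>e\<close> cannot start by time \<open>j\<close> either.\<close>

lemma truncated_weight_ge:
  assumes field: "\<And>j y. j \<le> L \<Longrightarrow> y \<in> carrier_vec kt \<Longrightarrow> starts_at_zero y \<Longrightarrow>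
      (j + 1) * c + 1 \<le> truncated_weight j (encode Gt y)"
    and u: "u \<in> laurent_vecs (digits p) k" and start: "starts_at_zero u" and "j \<le> L"
  shows "(j + 1) * c + 1 \<le> truncated_weight j (encode G u)"
  using \<open>j \<le> L\<close>
proof (induction j rule: less_induct)
  case (less j)
  show ?case
  proof (rule ccontr)
    assume "\<not> ?thesis"
    then have light: "window_weight 0 (int j) (encode G u) \<le> (j + 1) * c"
      by (simp add: truncated_weight_eq)
    \<comment> \<open>Subtracting the bound at \<open>t - 1\<close> from the weight up to \<open>j\<close> leaves each window \<open>[t, j]\<close> light.\<close>
    have suffix: "window_weight (int t) (int j) (encode G u) \<le> (j - t + 1) * c" if t: "t \<le> j" for t
    proof (cases t)
      case 0
      then show ?thesis using light by simp
    next
      case (Suc s)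
      have "(s + 1) * c + 1 \<le> truncated_weight s (encode G u)"
        using less.IH[of s] less.prems Suc t by simp
      moreover have "window_weight 0 (int j) (encode G u) =
          truncated_weight s (encode G u) + window_weight (int t) (int j) (encode G u)"
        using window_weight_split[of 0 "int t" "int j" "encode G u"] t Suc
        by (simp add: truncated_weight_eq)
      moreover have "(j + 1) * c = (s + 1) * c + (j - t + 1) * c"
        using t Suc by (simp add: add_mult_distrib[symmetric] del: mult_Suc)
      ultimately show ?thesis using light by linarith
    qed
    let ?I = "{S. S \<subseteq> {int j + 1..}}"
    have "\<forall>b<kt. support (layer u e $ b) \<in> ?I" if "e < r" for e
      using that
    proof (induction e rule: less_induct)
      case (less e)
      have lower: "support (layer u e' $ b) \<in> ?I" if "e' < e" "b < kt" for e' b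
        using less.IH[of e'] less.prems that by simp
      obtain S where S: "S \<in> ?I"
        "\<And>l. l < n \<Longrightarrow> support (encode Gt (layer u e) $ l) \<subseteq> support (encode G u $ l) \<union> S"
        using layer_word_support[OF support_ideal_atLeast u less.prems lower] by blast
      show ?case
      proof (rule ccontr)
        assume "\<not> ?thesis"
        then obtain b m where "b < kt" "m \<in> support (layer u e $ b)" "\<not> int j + 1 \<le> m" by auto
        then have bm: "b < kt" "m \<le> int j" "fls_nth (layer u e $ b) m \<noteq> 0"
          by (simp_all add: support_def)
        have nonneg: "0 \<le> m" if "b < kt" "fls_nth (layer u e $ b) m \<noteq> 0" for b m
        proof (rule ccontr)
          assume "\<not> 0 \<le> m"
          then have "fls_nth (u $ row_index b e) m = 0" if "first_exp b \<le> e"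
            using start u row_index(1)[of b e] \<open>b < kt\<close> less.prems that
            by (auto simp: starts_at_zero_def supported_from_def laurent_vecs_def)
          then show False using that by (simp add: layer_def split: if_splits)
        qed
        \<comment> \<open>The time at which layer \<open>e\<close> starts.\<close>
        define t where "t = (LEAST t. \<exists>b<kt. fls_nth (layer u e $ b) (int t) \<noteq> 0)"
        have ex: "\<exists>b<kt. fls_nth (layer u e $ b) (int (nat m)) \<noteq> 0"
          using bm nonneg[OF bm(1,3)] by auto
        then have t: "\<exists>b<kt. fls_nth (layer u e $ b) (int t) \<noteq> 0"
          unfolding t_def by (rule LeastI)
        have "t \<le> nat m" unfolding t_def by (rule Least_le) (rule ex)
        then have tj: "t \<le> j" using bm(2) by linarith
        have "supported_from (int t) (layer u e)"
          unfolding supported_from_def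
        proof (intro allI impI, rule ccontr)
          fix b m' assume b: "b < dim_vec (layer u e)" and m': "m' < int t"
            and nz: "fls_nth (layer u e $ b) m' \<noteq> 0"
          then have "b < kt" "0 \<le> m'" using nonneg by (simp_all add: layer_def)
          then have "t \<le> nat m'" unfolding t_def using nz by (intro Least_le) auto
          then show False using m' \<open>0 \<le> m'\<close> by linarith
        qed
        then have "(j - t + 1) * c + 1 \<le> window_weight (int t) (int t + int (j - t)) (encode Gt (layer u e))"
          using Gt t field[of "j - t"] \<open>j \<le> L\<close>
          by (intro window_weight_ge) (auto simp: layer_carrier)
        also have "\<dots> = window_weight (int t) (int j) (encode Gt (layer u e))" using tj by simp
        also have "\<dots> \<le> window_weight (int t) (int j) (encode G u)"
        proof (rule window_weight_mono)
          fix l m' assume l: "l < dim_vec (encode Gt (layer u e))" and m': "m' \<le> int j"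
            and "fls_nth (encode Gt (layer u e) $ l) m' \<noteq> 0"
          then have "m' \<in> support (encode G u $ l) \<union> S"
            using S(2)[of l] Gt by (auto simp: support_def)
          then show "fls_nth (encode G u $ l) m' \<noteq> 0" using S(1) m' by (auto simp: support_def)
        qed (use Gt in simp)
        also have "\<dots> \<le> (j - t + 1) * c" by (rule suffix[OF tj])
        finally show False by simp
      qed
    qed
    then have "support (u $ i) \<in> ?I" if "i < k" for i
      using support_row_in_ideal[OF u _ that] by blast
    moreover have "dim_vec u = k" using u by (auto simp: laurent_vecs_def)
    ultimately have "supported_from (int j + 1) u" by (simp add: supported_from_iff)
    then have "supported_from 1 u" by (rule supported_from_mono) simp
    then show False using start by (simp add: starts_at_zero_iff)
  qed
qed

lemma column_distance_G:
  assumes delay: "\<And>N y. y \<in> carrier_vec kt \<Longrightarrow> supported_from N (encode Gt y) \<Longrightarrow> supported_from N y"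
    and "kt > 0"
    and field: "\<And>j. j \<le> L \<Longrightarrow> column_distance UNIV Gt j = (j + 1) * c + 1"
    and "j \<le> L"
  shows "column_distance (digits p) G j = (j + 1) * c + 1"
proof (rule antisym)
  have all: "laurent_vecs UNIV kt = (carrier_vec kt :: 'b mod_ring fls vec set)"
    by (simp add: laurent_vecs_def)
  have Gt_delay: "reflects_delay UNIV Gt" using delay Gt by (simp add: reflects_delay_def all)
  have G_delay: "reflects_delay (digits p) G" using delay_free_G[OF delay] by (simp add: delay_free_iff)
  have "starts_at_zero (vec kt (\<lambda>_. 1 :: 'b mod_ring fls))"
    using \<open>kt > 0\<close> by (auto simp: starts_at_zero_def supported_from_def)
  then have ex: "\<exists>y\<in>laurent_vecs UNIV (dim_row Gt). starts_at_zero (y :: 'b mod_ring fls vec)"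
    using Gt all by (intro bexI[of _ "vec kt (\<lambda>_. 1)"]) auto
  then obtain y where y: "y \<in> carrier_vec kt" "starts_at_zero y"
    "truncated_weight j (encode Gt y) = column_distance UNIV Gt j"
    using column_distance_attained[OF Gt_delay ex, of j] Gt all by auto
  obtain u where u: "u \<in> laurent_vecs (digits p) k"
    "\<And>l. l < n \<Longrightarrow> support (encode G u $ l) = support (encode Gt y $ l)"
    using socle_word[OF y(1)] by blast
  have nth: "fls_nth (encode G u $ l) m \<noteq> 0 \<longleftrightarrow> fls_nth (encode Gt y $ l) m \<noteq> 0" if "l < n" for l m
    using u(2)[OF that] by (auto simp: support_def)
  have "starts_at_zero (encode Gt y)"
    using starts_at_zero_encode_iff[OF Gt_delay] y Gt all by simp
  then have "starts_at_zero (encode G u)"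
    using Gt nth by (auto simp: starts_at_zero_def supported_from_iff u(2))
  then have "starts_at_zero u" using starts_at_zero_encode_iff[OF G_delay] u(1) by simp
  then have "column_distance (digits p) G j \<le> truncated_weight j (encode G u)"
    using column_distance_le[OF G_delay] u(1) by simp
  also have "\<dots> = truncated_weight j (encode Gt y)"
    unfolding truncated_weight_def using Gt nth by (intro arg_cong[where f = card]) auto
  finally show "column_distance (digits p) G j \<le> (j + 1) * c + 1"
    using y(3) field[OF \<open>j \<le> L\<close>] by simp
  have low: "(j + 1) * c + 1 \<le> truncated_weight j (encode Gt y)"
    if "j \<le> L" "y \<in> carrier_vec kt" "starts_at_zero y" for j y
    using column_distance_le[OF Gt_delay, of y j] field[OF that(1)] that Gt all by simp
  obtain u' where "u' \<in> laurent_vecs (digits p) k" "starts_at_zero u'"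
    "truncated_weight j (encode G u') = column_distance (digits p) G j"
    using column_distance_attained[OF G_delay, of j] u(1) \<open>starts_at_zero u\<close> by auto
  then show "(j + 1) * c + 1 \<le> column_distance (digits p) G j"
    using truncated_weight_ge[of L c u' j, OF low] \<open>j \<le> L\<close> by simp
qed

end


section \<open>The range of the distance profile\<close>

lemma ceiling_divide_eq_int: "\<lceil>real k / real r\<rceil> = int (nat \<lceil>real k / real r\<rceil>)"
proof -
  have "0 \<le> real k / real r" by simp
  then have "- 1 < real k / real r" by linarith
  then show ?thesis by (simp add: zero_le_ceiling)
qed

lemma nat_ceiling_divide:
  assumes "r > 0"
  shows "nat \<lceil>real k / real r\<rceil> = (if r dvd k then k div r else Suc (k div r))"
proof (cases "r dvd k")
  case True
  then have "real k / real r = real (k div r)" by (simp add: real_of_nat_div)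
  then show ?thesis using True by simp
next
  case False
  have "real k = real (k div r) * real r + real (k mod r)"
    by (metis div_mult_mod_eq of_nat_add of_nat_mult)
  then have eq: "real k / real r = real (k div r) + real (k mod r) / real r"
    using assms by (simp add: field_simps)
  have "0 < k mod r" "k mod r < r" using False assms by (auto simp: dvd_eq_mod_eq_0)
  then have "0 < real (k mod r) / real r" "real (k mod r) / real r < 1" by simp_all
  then have "\<lceil>real k / real r\<rceil> = int (k div r) + 1"
    unfolding eq by (intro ceiling_unique) simp_all
  then show ?thesis using False by simp
qed

text \<open>The bound \<open>B(j) \<le> SB\<close> reads \<open>j (n - kt) \<le> n \<nu> = \<nu> (n - kt) + kt \<nu>\<close>, so the range of the
  distance profile is the same over the ring and over the field.\<close>

lemma mdp_L_le:
  assumes "k > 0" and kt: "kt = nat \<lceil>real k / real r\<rceil>" and "kt < n" and "j \<le> mdp_L r n k (k * \<nu>)"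
  shows "j \<le> \<nu> + kt * \<nu> div (n - kt)"
proof -
  have ceil: "\<lceil>real k / real r\<rceil> = int kt" unfolding kt by (rule ceiling_divide_eq_int)
  have SB: "mdp_SB r n k (k * \<nu>) = int n * (int \<nu> + 1) - int kt + 1"
  proof -
    have "real k / real r * (real \<nu> + 1) - real (k * \<nu>) / real r = real k / real r"
      by (simp add: field_simps add_divide_distrib)
    then show ?thesis using \<open>k > 0\<close> ceil by (simp add: mdp_SB_def)
  qed
  have iff: "mdp_B r n k i \<le> mdp_SB r n k (k * \<nu>) \<longleftrightarrow> i \<le> \<nu> + kt * \<nu> div (n - kt)" for i
  proof -
    have "mdp_B r n k i \<le> mdp_SB r n k (k * \<nu>) \<longleftrightarrow> int (i * (n - kt)) \<le> int (n * \<nu>)"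
      unfolding SB using \<open>kt < n\<close> by (simp add: mdp_B_def ceil of_nat_diff algebra_simps)
    also have "\<dots> \<longleftrightarrow> i * (n - kt) \<le> n * \<nu>" by (simp only: of_nat_le_iff)
    also have "\<dots> \<longleftrightarrow> i \<le> n * \<nu> div (n - kt)" using \<open>kt < n\<close> by (simp add: less_eq_div_iff_mult_less_eq)
    also have "n * \<nu> = \<nu> * (n - kt) + kt * \<nu>" using \<open>kt < n\<close> by (simp add: algebra_simps)
    also have "\<dots> div (n - kt) = \<nu> + kt * \<nu> div (n - kt)" using \<open>kt < n\<close> by simp
    finally show ?thesis .
  qed
  have "{i. mdp_B r n k i \<le> mdp_SB r n k (k * \<nu>)} = {..\<nu> + kt * \<nu> div (n - kt)}"
    using iff by auto
  then have "mdp_L r n k (k * \<nu>) = Max {..\<nu> + kt * \<nu> div (n - kt)}" by (simp only: mdp_L_def)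
  also have "\<dots> = \<nu> + kt * \<nu> div (n - kt)" by (intro Max_eqI) auto
  finally show ?thesis using assms(4) by simp
qed

theorem theorem23:
  fixes p r n k \<delta> \<nu> kt \<delta>t :: nat
    and Gt :: "'b::prime_card mod_ring poly mat"
    and Ct :: "'b mod_ring fls vec set"
    and G :: "'a::nontriv mod_ring poly mat"
    and C :: "'a mod_ring fls vec set"
  assumes "prime p" and "r \<ge> 1" and "n \<ge> 1" and "k \<ge> 1" and "k dvd \<delta>"
    and "CARD('b) = p" and "CARD('a) = p ^ r"
    and "\<nu> = \<delta> div k" and "kt = nat \<lceil>real k / real r\<rceil>" and "\<delta>t = kt * \<nu>"
    and "kt < n"
    and "field_mdp_code n kt \<delta>t Ct"
    and "minimal_basic_encoder n kt Gt Ct"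
    and "\<forall>i<kt. \<forall>l<n. degree (Gt $$ (i, l)) \<le> \<nu>"
    and "G = block_encoder p r n k Gt"
    and "C = encode G ` laurent_vecs (digits p) k"
  shows "p_encoder p n k G C \<and> ring_mdp_code p r n k \<delta> C"
proof -
  note enc = minimal_basic_encoder_properties[OF assms(13)]
  have kt_eq: "kt = (if r dvd k then k div r else Suc (k div r))"
    using assms(2,9) by (simp add: nat_ceiling_divide)
  have kt_pos: "kt > 0"
    using assms(4) by (auto simp: kt_eq elim!: dvdE)
  have \<delta>: "\<delta> = k * \<nu>" using assms(5,8) by simp
  interpret block_code p r "\<lambda>x :: 'b mod_ring. of_int (to_int_mod_ring x) :: 'a mod_ring" n k kt Gt
    using assms(6,7) kt_eq enc(1) by unfold_locales auto
  have G_eq: "G = block_encoder p r n k Gt" by (rule assms(15))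
  have all: "laurent_vecs UNIV kt = (carrier_vec kt :: 'b mod_ring fls vec set)"
    by (simp add: laurent_vecs_def)
  let ?L = "\<nu> + kt * \<nu> div (n - kt)"
  obtain H where H: "minimal_basic_encoder n kt H Ct"
    "\<forall>j \<le> \<delta>t div kt + \<delta>t div (n - kt). column_distance UNIV H j = (j + 1) * (n - kt) + 1"
    using assms(12) by (auto simp: field_mdp_code_def)
  note H_props = minimal_basic_encoder_properties[OF H(1)]
  have delay: "reflects_delay UNIV Gt" "reflects_delay UNIV H"
    using enc(1,3) H_props(1,3) by (auto simp: reflects_delay_def all)
  have "encode Gt ` carrier_vec kt = encode H ` carrier_vec kt" using enc(2) H_props(2) by simp
  then have "column_distance UNIV Gt j = column_distance UNIV H j" for j
    using enc(1) H_props(1) by (simp add: column_distance_altdef[OF delay(1)] column_distance_altdef[OF delay(2)] all)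
  then have dist: "column_distance UNIV Gt j = (j + 1) * (n - kt) + 1" if "j \<le> ?L" for j
    using H(2) that kt_pos by (simp add: assms(10))
  have row_deg: "row_degree Gt b = \<nu>" if b: "b < kt" for b
  proof (rule antisym)
    show "\<nu> \<le> row_degree Gt b"
      by (rule row_degree_ge_if_column_distance[OF enc(1) delay(1) b assms(11) dist]) simp
    show "row_degree Gt b \<le> \<nu>"
      unfolding row_degree_def using enc(1) b assms(3,14) by (intro Max.boundedI) (auto simp: lessThan_empty_iff)
  qed
  have minimal: "minimal_p_encoder p n k G C"
    using minimal_p_encoder_G[OF enc(3,4,5)] by (simp add: G_eq assms(16))
  moreover have "(\<Sum>i<k. row_degree G i) = \<delta>"
    using row_decomposition(1) by (simp add: G_eq row_degree_G row_deg \<delta>)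
  ultimately have nkd: "nkd_code p n k \<delta> C"
    using ring_conv_code_G by (auto simp: nkd_code_def G_eq assms(16))
  have "int (column_distance (digits p) G' j) = mdp_B r n k j"
    if G': "p_encoder p n (dim_row G') G' C" "delay_free p G'" and j: "j \<le> mdp_L r n k \<delta>" for G' j
  proof -
    have "reflects_delay (digits p) G" "reflects_delay (digits p) G'"
      using minimal G'(2) by (simp_all add: minimal_p_encoder_def delay_free_iff)
    moreover have "encode G' ` laurent_vecs (digits p) (dim_row G') =
        encode G ` laurent_vecs (digits p) (dim_row G)"
      using G'(1) assms(16) by (simp add: p_encoder_def G_eq)
    ultimately have "column_distance (digits p) G' j = column_distance (digits p) G j"
      by (simp add: column_distance_altdef)
    also have "\<dots> = (j + 1) * (n - kt) + 1"
      unfolding G_eq using mdp_L_le[of k kt r n j \<nu>] assms(4,9,11) j \<delta>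
      by (intro column_distance_G[OF enc(3) kt_pos dist]) simp_all
    finally have "column_distance (digits p) G' j = (j + 1) * (n - kt) + 1" .
    moreover have "\<lceil>real k / real r\<rceil> = int kt" unfolding assms(9) by (rule ceiling_divide_eq_int)
    ultimately show ?thesis
      unfolding mdp_B_def
      by (simp only: of_nat_add of_nat_mult of_nat_diff[OF less_imp_le[OF assms(11)]] of_nat_1 mult.commute)
  qed
  then show ?thesis using nkd minimal by (simp add: ring_mdp_code_def minimal_p_encoder_def)
qed

end
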